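(* Suppose that $Q=\{q_k(x)\}_{k=0}^\infty$ is a simple set of polynomials such that each $q_k(x)$ has only simple real zeros, normalized so that the leading coefficient of each $q_k(x)$ is positive. If $\{\gamma_k\}_{k=0}^\infty$ is a $Q$-multiplier sequence, then $\{\gamma_k\}_{k=0}^\infty$ is a Hermite multiplier sequence.
   Context: All polynomials have real coefficients. A simple set of polynomials is a sequence $Q=\{q_k(x)\}_{k=0}^\infty$ of real polynomials with $\deg q_k=k$ for $k=0,1,2,\ldots$ (so $q_0$ is a nonzero constant, and $Q$ is a basis of $\mathbb{R}[x]$). A polynomial "has only real zeros" if it has no non-real complex zeros or is identically zero (nonzero constants also qualify). A sequence of real numbers $\{\gamma_k\}_{k=0}^\infty$ is a $Q$-multiplier sequence if, for every $n$ and all real $a_0,\ldots,a_n$, the polynomial $\sum_{k=0}^n a_k\gamma_k q_k(x)$ has only real zeros whenever $\sum_{k=0}^n a_k q_k(x)$ has only real zeros. A Hermite multiplier sequence is a $Q$-multiplier sequence for $Q=\{H_k(x)\}_{k=0}^\infty$, where $H_k(x)=(-1)^k e^{x^2}\frac{d^k}{dx^k}e^{-x^2}$ are the Hermite polynomials. *)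

theory Defs
  imports "HOL-Analysis.Analysis" "HOL-Computational_Algebra.Polynomial"
begin

definition simple_set :: "(nat \<Rightarrow> real poly) \<Rightarrow> bool" where
  "simple_set q \<longleftrightarrow> (\<forall>k. q k \<noteq> 0 \<and> degree (q k) = k)"

definition only_real_zeros :: "real poly \<Rightarrow> bool" where
  "only_real_zeros p \<longleftrightarrow>
     p = 0 \<or> (\<forall>z. poly (map_poly complex_of_real p) z = 0 \<longrightarrow> z \<in> \<real>)"

definition only_simple_real_zeros :: "real poly \<Rightarrow> bool" where
  "only_simple_real_zeros p \<longleftrightarrow>
     (\<forall>z. poly (map_poly complex_of_real p) z = 0 \<longrightarrow>
          z \<in> \<real> \<and> order z (map_poly complex_of_real p) = 1)"

definition multiplier_sequence :: "(nat \<Rightarrow> real poly) \<Rightarrow> (nat \<Rightarrow> real) \<Rightarrow> bool" where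
  "multiplier_sequence q \<gamma> \<longleftrightarrow>
     (\<forall>n (a :: nat \<Rightarrow> real).
        only_real_zeros (\<Sum>k\<le>n. smult (a k) (q k)) \<longrightarrow>
        only_real_zeros (\<Sum>k\<le>n. smult (a k * \<gamma> k) (q k)))"

(* Rodrigues formula; poly_hermite below shows that such a polynomial exists. *)
definition hermite :: "nat \<Rightarrow> real poly" where
  "hermite k = (THE p. \<forall>x. poly p x =
     (-1) ^ k * exp (x\<^sup>2) * (deriv ^^ k) (\<lambda>t. exp (- (t\<^sup>2))) x)"

lemma gaussian_deriv:
  "\<exists>p :: real poly. \<forall>x. (deriv ^^ k) (\<lambda>t. exp (- (t\<^sup>2))) x = poly p x * exp (- (x\<^sup>2))"
proof (induction k)
  case 0
  show ?case by (rule exI[of _ 1]) simp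
next
  case (Suc k)
  then obtain p :: "real poly"
    where "\<And>x. (deriv ^^ k) (\<lambda>t. exp (- (t\<^sup>2))) x = poly p x * exp (- (x\<^sup>2))"
    by blast
  then have p: "(deriv ^^ k) (\<lambda>t. exp (- (t\<^sup>2))) = (\<lambda>x. poly p x * exp (- (x\<^sup>2)))"
    by (rule ext)
  have "((\<lambda>t. poly p t * exp (- (t\<^sup>2))) has_field_derivative
          poly (pderiv p - [:0, 2:] * p) x * exp (- (x\<^sup>2))) (at x)" for x
    by (rule derivative_eq_intros poly_DERIV refl)+ (simp add: algebra_simps)
  then have "deriv (\<lambda>t. poly p t * exp (- (t\<^sup>2))) x =
      poly (pderiv p - [:0, 2:] * p) x * exp (- (x\<^sup>2))" for x
    by (rule DERIV_imp_deriv)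
  then show ?case
    by (intro exI[of _ "pderiv p - [:0, 2:] * p"]) (simp add: p)
qed

lemma poly_hermite:
  "poly (hermite k) x = (-1) ^ k * exp (x\<^sup>2) * (deriv ^^ k) (\<lambda>t. exp (- (t\<^sup>2))) x"
proof -
  let ?P = "\<lambda>p. \<forall>x. poly p x = (-1) ^ k * exp (x\<^sup>2) * (deriv ^^ k) (\<lambda>t. exp (- (t\<^sup>2))) x"
  obtain r :: "real poly"
    where r: "\<And>x. (deriv ^^ k) (\<lambda>t. exp (- (t\<^sup>2))) x = poly r x * exp (- (x\<^sup>2))"
    using gaussian_deriv by blast
  have "exp (y\<^sup>2) * (poly r y * exp (- (y\<^sup>2))) = poly r y" for y
    by (simp add: exp_minus)
  then have "?P (smult ((-1) ^ k) r)"
    by (simp add: r mult.assoc)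
  moreover have "p = p'" if "?P p" "?P p'" for p p'
    using that by (intro poly_eq_poly_eq_iff[THEN iffD1] ext) simp
  ultimately have "?P (hermite k)"
    unfolding hermite_def by (intro theI[of ?P]) blast+
  then show ?thesis by blast
qed

end

theory Submission
  imports Defs "HOL-Computational_Algebra.Fundamental_Theorem_Algebra"
begin

text \<open>
  The idea is to extract from the basis \<open>q\<close> only what it forces on the numbers \<open>\<gamma> k\<close>, and to show
  that this much already suffices for the Hermite basis.

  What \<open>q\<close> forces. Rescaling, \<open>\<epsilon>\<^sup>k q\<^sub>k(x/\<epsilon>)\<close> tends to a multiple of \<open>x\<^sup>k\<close>, so \<open>\<gamma>\<close> is a multiplier
  sequence in the classical sense, for the monomials (\<open>hadamard_real_rooted\<close>). Hence \<open>\<bar>\<gamma>\<bar>\<close> is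
  log-concave, the nonzero terms are consecutive, and the signs are constant or alternate.
  The simple zeros give more: for small \<open>b > 0\<close> the polynomial \<open>q\<^sub>k\<^sub>+\<^sub>2 + b q\<^sub>k\<close> keeps its real zeros,
  for large \<open>b\<close> it loses some. The multiplier replaces \<open>b\<close> by \<open>r b\<close> with \<open>r = \<gamma> k / \<gamma> (k + 2)\<close>, and
  iterating shows \<open>r \<le> 1\<close> (\<open>abs_multiplier_le_two_steps\<close>). With log-concavity, \<open>\<bar>\<gamma>\<bar>\<close> is
  nondecreasing. The exception is a sequence with a zero after a nonzero term: then arbitrary
  small perturbations of some \<open>q\<^sub>m\<close> are mapped to arbitrary combinations of the surviving
  terms below \<open>m\<close>, which leaves room only for two adjacent nonzero terms
  (\<open>multiplier_support\<close>); such a sequence is harmless because all combinations of \<open>H\<^sub>i\<close> and \<open>H\<^sub>i\<^sub>+\<^sub>1\<close> are real-rooted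
  (\<open>hermite_adjacent_real_rooted\<close>).

  What the Hermite basis needs. Let \<open>\<beta> = \<bar>\<gamma>\<bar>\<close>, a nonnegative nondecreasing classical multiplier
  sequence. All forward differences \<open>c\<^sub>j = \<Delta>\<^sup>j \<beta>(0)\<close> are nonnegative, because monotonicity passes
  from \<open>\<beta>\<close> to \<open>\<Delta>\<beta>\<close> (\<open>differences_monotone\<close>), and the polynomials \<open>\<Sum> binomial(n,j) c\<^sub>j x\<^sup>j\<close> have only
  real zeros, being Moebius transforms of the Jensen polynomials of \<open>\<beta>\<close>. So \<open>\<beta> k = \<Sum> binomial(k,j) c\<^sub>j\<close>
  is a limit of sequences \<open>k \<mapsto> \<Sum> p\<^sub>j k(k-1)\<cdots>(k-j+1)\<close> where \<open>P = \<Sum> p\<^sub>j x\<^sup>j\<close> is, up to a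
  constant, a product of factors \<open>t + x\<close> with \<open>t \<ge> 0\<close>; by another limit, \<open>t > 0\<close>.

  For such a \<open>P\<close> the operator on Hermite expansions is \<open>\<Sum> p\<^sub>j (x - D/2)\<^sup>j D\<^sup>j\<close>, since
  \<open>2x - D\<close> raises and \<open>D\<close> lowers the index of \<open>H\<^sub>k\<close>. Let \<open>D\<close> on the right act on a second variable
  \<open>y\<close> and \<open>x - D/2\<close> become \<open>x - (\<partial>\<^sub>x + \<partial>\<^sub>y)/2\<close>. These commute, so the operator factors into the maps
  \<open>G \<mapsto> t G + (x - (\<partial>\<^sub>x + \<partial>\<^sub>y)/2) \<partial>\<^sub>y G\<close> followed by the restriction to \<open>y = x\<close>, and each of these maps
  preserves the property of having no zeros with both variables in the upper half-plane,
  as long as the leading coefficient in \<open>y\<close> is a nonzero constant (\<open>hermite_step_stable\<close>).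
\<close>

section \<open>Real polynomials with only real zeros\<close>

abbreviation cpoly :: "real poly \<Rightarrow> complex poly" where
  "cpoly \<equiv> map_poly complex_of_real"

lemma cpoly_simps [simp]:
  "cpoly (pCons a p) = pCons (of_real a) (cpoly p)"
  "cpoly (p + r) = cpoly p + cpoly r"
  "cpoly (p - r) = cpoly p - cpoly r"
  "cpoly (- p) = - cpoly p"
  "cpoly (smult a p) = smult (of_real a) (cpoly p)"
  "cpoly p = 0 \<longleftrightarrow> p = 0"
  "degree (cpoly p) = degree p"
  by (simp_all add: map_poly_pCons map_poly_smult map_poly_eq_0_iff degree_map_poly
      poly_eq_iff coeff_map_poly)

lemma cpoly_mult [simp]: "cpoly (p * r) = cpoly p * cpoly r"
  by (induction p) (simp_all add: algebra_simps)

lemma cpoly_sum: "cpoly (sum f A) = (\<Sum>i\<in>A. cpoly (f i))"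
  by (induction A rule: infinite_finite_induct) simp_all

lemma cpoly_pderiv: "cpoly (pderiv p) = pderiv (cpoly p)"
  by (intro poly_eqI) (simp add: coeff_map_poly coeff_pderiv)

lemma poly_cpoly_of_real [simp]: "poly (cpoly p) (of_real x) = of_real (poly p x)"
  by (induction p) simp_all

lemma poly_cpoly_cnj: "poly (cpoly p) (cnj z) = cnj (poly (cpoly p) z)"
  by (induction p) simp_all

text \<open>Nonreal zeros of a real polynomial come in conjugate pairs, so the upper half-plane is enough;
  this is the form in which real-rootedness is proved throughout.\<close>

lemma only_real_zeros_iff_upper:
  "only_real_zeros p \<longleftrightarrow> p = 0 \<or> (\<forall>z. Im z > 0 \<longrightarrow> poly (cpoly p) z \<noteq> 0)"
proof -
  have "Im z = 0" if *: "\<forall>z. Im z > 0 \<longrightarrow> poly (cpoly p) z \<noteq> 0" "poly (cpoly p) z = 0" for z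
  proof -
    have "poly (cpoly p) (cnj z) = 0"
      using that by (simp add: poly_cpoly_cnj)
    then have "\<not> Im (cnj z) > 0" "\<not> Im z > 0"
      using that by blast+
    then show ?thesis by simp
  qed
  then show ?thesis
    unfolding only_real_zeros_def by (auto simp: complex_is_Real_iff)
qed

lemma only_real_zerosD:
  "only_real_zeros p \<Longrightarrow> p \<noteq> 0 \<Longrightarrow> Im z \<noteq> 0 \<Longrightarrow> poly (cpoly p) z \<noteq> 0"
  by (auto simp: only_real_zeros_def complex_is_Real_iff)

lemma only_real_zeros_0 [simp]: "only_real_zeros 0"
  by (simp add: only_real_zeros_def)

lemma only_real_zeros_mult_iff:
  assumes "p \<noteq> 0" "r \<noteq> 0"
  shows "only_real_zeros (p * r) \<longleftrightarrow> only_real_zeros p \<and> only_real_zeros r"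
  using assms by (auto simp: only_real_zeros_def)

lemma only_real_zeros_mult:
  "only_real_zeros p \<Longrightarrow> only_real_zeros r \<Longrightarrow> only_real_zeros (p * r)"
  by (auto simp: only_real_zeros_def)

lemma only_real_zeros_const [simp]: "only_real_zeros [:c:]"
  by (auto simp: only_real_zeros_def)

lemma only_real_zeros_smult_iff [simp]:
  "only_real_zeros (smult c p) \<longleftrightarrow> c = 0 \<or> only_real_zeros p"
  by (auto simp: only_real_zeros_def)

lemma only_real_zeros_linear [simp]: "only_real_zeros [:a, b:]"
proof (cases "b = 0")
  case False
  have "Im z = 0" if "of_real a + z * of_real b = 0" for z
    using arg_cong[OF that, of Im] False by simp
  then show ?thesis
    unfolding only_real_zeros_iff_upper by auto
qed auto

lemma only_real_zeros_prod_list: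
  "(\<And>p. p \<in> set ps \<Longrightarrow> only_real_zeros p) \<Longrightarrow> only_real_zeros (prod_list ps)"
proof (induction ps)
  case Nil
  show ?case using only_real_zeros_const[of 1] by (simp add: one_pCons)
qed (simp add: only_real_zeros_mult)

lemma only_real_zeros_pcompose_scale:
  assumes "c \<noteq> 0"
  shows "only_real_zeros (pcompose p [:0, c:]) \<longleftrightarrow> only_real_zeros p"
proof -
  have *: "only_real_zeros (pcompose p [:0, c:])" if "c \<noteq> 0" "only_real_zeros p" for p and c :: real
  proof -
    have eq: "poly (cpoly (pcompose p [:0, c:])) z = poly (cpoly p) (of_real c * z)" for z
      by (induction p) (simp_all add: pcompose_pCons algebra_simps)
    show ?thesis
    proof (cases "p = 0")
      case False
      show ?thesis
        unfolding only_real_zeros_iff_upper eq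
        using only_real_zerosD[OF that(2) False] that(1) by auto
    qed simp
  qed
  have "pcompose (pcompose p [:0, c:]) [:0, 1 / c:] = p"
    using assms by (simp flip: pcompose_assoc add: pcompose_pCons pcompose_idR)
  then show ?thesis
    using *[of c p] *[of "1 / c" "pcompose p [:0, c:]"] assms by auto
qed

text \<open>By the fundamental theorem of algebra a nonconstant real-rooted polynomial splits off a real
  linear factor, and the cofactor is real-rooted again. The inequalities below follow by this
  induction.\<close>

lemma real_rooted_induct [consumes 1, case_names zero const linear]:
  assumes "only_real_zeros p"
    and "P 0"
    and "\<And>c. c \<noteq> 0 \<Longrightarrow> P [:c:]"
    and "\<And>a r. only_real_zeros r \<Longrightarrow> r \<noteq> 0 \<Longrightarrow> P r \<Longrightarrow> P ([:- a, 1:] * r)"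
  shows "P p"
  using assms(1)
proof (induction "degree p" arbitrary: p)
  case 0
  then obtain c where "p = [:c:]" by (metis degree_0_id)
  with assms(2,3) show ?case by (cases "c = 0") auto
next
  case (Suc n)
  then have [simp]: "p \<noteq> 0" by auto
  have "\<not> constant (poly (cpoly p))"
    using Suc by (simp add: constant_degree)
  then obtain z where z: "poly (cpoly p) z = 0"
    using fundamental_theorem_of_algebra by blast
  then have "z \<in> \<real>" using Suc.prems by (simp add: only_real_zeros_def)
  then obtain a where "z = of_real a" by (auto elim: Reals_cases)
  with z have "poly p a = 0" by simp
  then obtain r where r: "p = [:- a, 1:] * r"
    by (auto simp: poly_eq_0_iff_dvd elim: dvdE)
  then have "r \<noteq> 0" by auto
  have "degree p = Suc (degree r)"
    unfolding r using \<open>r \<noteq> 0\<close> by (subst degree_mult_eq) auto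
  with Suc have "n = degree r" by simp
  moreover have "only_real_zeros r"
    using Suc.prems \<open>r \<noteq> 0\<close> unfolding r
    by (subst (asm) only_real_zeros_mult_iff) auto
  ultimately show ?case
    using Suc.hyps(1)[of r] assms(4)[of r a] \<open>r \<noteq> 0\<close> r by blast
qed

lemma real_rooted_factorization:
  assumes "only_real_zeros p"
  shows "\<exists>c xs. p = smult c (\<Prod>x\<leftarrow>xs. [:- x, 1:])"
  using assms
proof (induction rule: real_rooted_induct)
  case zero
  show ?case by (rule exI[of _ 0]) simp
next
  case (const c)
  show ?case by (rule exI[of _ c], rule exI[of _ "[]"]) simp
next
  case (linear a r)
  then obtain c xs where "r = smult c (\<Prod>x\<leftarrow>xs. [:- x, 1:])" by blast
  then show ?case
    by (intro exI[of _ c] exI[of _ "a # xs"]) (simp add: algebra_simps)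
qed

text \<open>Away from the zeros this says that \<open>ln \<bar>p\<bar>\<close> is concave. It is the source of all
  obstructions to real-rootedness used below: it excludes a polynomial by inspection at a single
  real point.\<close>

lemma laguerre_inequality:
  assumes "only_real_zeros p"
  shows "poly p x * poly (pderiv (pderiv p)) x \<le> (poly (pderiv p) x)\<^sup>2"
  using assms
proof (induction rule: real_rooted_induct)
  case (linear a r)
  let ?r = "poly r x" and ?d = "poly (pderiv r) x" and ?e = "poly (pderiv (pderiv r)) x"
  have "0 \<le> ?r\<^sup>2 + (x - a)\<^sup>2 * (?d\<^sup>2 - ?r * ?e)"
    using linear by (intro add_nonneg_nonneg mult_nonneg_nonneg) auto
  then show ?case
    by (simp add: pderiv_mult pderiv_pCons pderiv_add pderiv_smult pderiv_diff algebra_simps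
        power2_eq_square del: mult_pCons_left)
qed (simp_all)

text \<open>Each factor \<open>\<bar>z - x\<^sub>i\<bar>\<close> with \<open>x\<^sub>i\<close> real grows along vertical lines away from the real axis.\<close>

lemma real_rooted_norm_mono:
  assumes "only_real_zeros p" "\<bar>s\<bar> \<le> \<bar>t\<bar>"
  shows "cmod (poly (cpoly p) (Complex x s)) \<le> cmod (poly (cpoly p) (Complex x t))"
  using assms(1)
proof (induction rule: real_rooted_induct)
  case (linear a r)
  have "cmod (Complex (x - a) s) \<le> cmod (Complex (x - a) t)"
    using assms(2) by (simp add: complex_norm abs_le_square_iff)
  moreover have "poly (cpoly [:- a, 1:]) (Complex x u) = Complex (x - a) u" for u
    by (simp add: complex_eq_iff)
  ultimately show ?case
    using linear by (simp add: norm_mult mult_mono del: mult_pCons_left cpoly_simps(1))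
qed simp_all

section \<open>Coefficientwise limits and perturbation\<close>

definition coeff_lim :: "('b \<Rightarrow> real poly) \<Rightarrow> real poly \<Rightarrow> 'b filter \<Rightarrow> bool" where
  "coeff_lim P p F \<longleftrightarrow> (\<forall>i. ((\<lambda>m. coeff (P m) i) \<longlongrightarrow> coeff p i) F)"

lemma coeff_lim_const: "coeff_lim (\<lambda>_. p) p F"
  by (simp add: coeff_lim_def)

lemma coeff_lim_add:
  "coeff_lim P p F \<Longrightarrow> coeff_lim R r F \<Longrightarrow> coeff_lim (\<lambda>m. P m + R m) (p + r) F"
  by (auto simp: coeff_lim_def intro!: tendsto_intros)

lemma coeff_lim_smult:
  "(c \<longlongrightarrow> c') F \<Longrightarrow> coeff_lim P p F \<Longrightarrow> coeff_lim (\<lambda>m. smult (c m) (P m)) (smult c' p) F"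
  by (auto simp: coeff_lim_def intro!: tendsto_intros)

lemma coeff_lim_sum:
  "(\<And>i. i \<in> A \<Longrightarrow> coeff_lim (P i) (p i) F) \<Longrightarrow>
    coeff_lim (\<lambda>m. \<Sum>i\<in>A. P i m) (\<Sum>i\<in>A. p i) F"
  by (auto simp: coeff_lim_def coeff_sum intro!: tendsto_sum)

lemma coeff_lim_mult:
  "coeff_lim P p F \<Longrightarrow> coeff_lim R r F \<Longrightarrow> coeff_lim (\<lambda>m. P m * R m) (p * r) F"
  by (auto simp: coeff_lim_def coeff_mult intro!: tendsto_intros)

lemma coeff_lim_prod_list:
  "(\<And>x. x \<in> set xs \<Longrightarrow> coeff_lim (P x) (p x) F) \<Longrightarrow>
    coeff_lim (\<lambda>m. \<Prod>x\<leftarrow>xs. P x m) (\<Prod>x\<leftarrow>xs. p x) F"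
  by (induction xs) (auto intro!: coeff_lim_mult coeff_lim_const)

lemma coeff_lim_linear:
  "(a \<longlongrightarrow> a') F \<Longrightarrow> coeff_lim (\<lambda>m. [:a m, 1:]) [:a', 1:] F"
  by (auto simp: coeff_lim_def coeff_pCons split: nat.splits)

lemma poly_eq_sum_le:
  fixes p :: "'a::comm_semiring_1 poly"
  assumes "degree p \<le> n"
  shows "poly p x = (\<Sum>i\<le>n. coeff p i * x ^ i)"
  unfolding poly_altdef using assms
  by (intro sum.mono_neutral_left) (auto simp: coeff_eq_0)

lemma coeff_lim_poly:
  assumes "coeff_lim P p F" "\<And>m. degree (P m) \<le> n" "degree p \<le> n"
  shows "((\<lambda>m. poly (P m) x) \<longlongrightarrow> poly p x) F"
  using assms unfolding poly_eq_sum_le[OF assms(2)] poly_eq_sum_le[OF assms(3)] coeff_lim_def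
  by (auto intro!: tendsto_intros)

lemma coeff_lim_cpoly:
  assumes "coeff_lim P p F" "\<And>m. degree (P m) \<le> n" "degree p \<le> n"
  shows "((\<lambda>m. poly (cpoly (P m)) z) \<longlongrightarrow> poly (cpoly p) z) F"
proof -
  have "poly (cpoly r) z = (\<Sum>i\<le>n. of_real (coeff r i) * z ^ i)" if "degree r \<le> n" for r
    using that by (subst poly_eq_sum_le[of _ n]) (auto simp: coeff_map_poly)
  then show ?thesis
    using assms by (auto simp: coeff_lim_def intro!: tendsto_intros)
qed

lemma coeff_lim_degree:
  assumes "coeff_lim P p F" "\<And>m. degree (P m) \<le> n" "F \<noteq> bot"
  shows "degree p \<le> n"
proof (rule degree_le, intro allI impI)
  fix i assume "n < i"
  then have "coeff (P m) i = 0" for m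
    using assms(2)[of m] by (intro coeff_eq_0) simp
  moreover have "((\<lambda>m. coeff (P m) i) \<longlongrightarrow> coeff p i) F"
    using assms(1) by (simp add: coeff_lim_def)
  ultimately show "coeff p i = 0"
    using assms(3) by (simp add: tendsto_const_iff)
qed

text \<open>If the limit vanished at a nonreal \<open>z\<close>, then by \<open>real_rooted_norm_mono\<close> it would vanish on
  the whole vertical segment between \<open>z\<close> and the real axis, hence identically. The bound on the
  degrees makes coefficientwise convergence imply pointwise convergence.\<close>

lemma only_real_zeros_closed:
  assumes lim: "coeff_lim P p F" and deg: "\<And>m. degree (P m) \<le> n" and F: "F \<noteq> bot"
    and RR: "eventually (\<lambda>m. only_real_zeros (P m)) F"
  shows "only_real_zeros p"
proof -
  have degp: "degree p \<le> n" by (rule coeff_lim_degree[OF lim deg F])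
  have False if "p \<noteq> 0" "Im z > 0" "poly (cpoly p) z = 0" for z
  proof -
    have "poly (cpoly p) (Complex (Re z) s) = 0" if "\<bar>s\<bar> \<le> Im z" for s
    proof -
      have 1: "((\<lambda>m. cmod (poly (cpoly (P m)) (Complex (Re z) s))) \<longlongrightarrow>
          cmod (poly (cpoly p) (Complex (Re z) s))) F"
        by (intro tendsto_norm coeff_lim_cpoly[OF lim deg degp])
      have 2: "((\<lambda>m. cmod (poly (cpoly (P m)) z)) \<longlongrightarrow> cmod (poly (cpoly p) z)) F"
        by (intro tendsto_norm coeff_lim_cpoly[OF lim deg degp])
      have "eventually (\<lambda>m. cmod (poly (cpoly (P m)) (Complex (Re z) s)) \<le>
          cmod (poly (cpoly (P m)) z)) F"
        using RR
      proof eventually_elim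
        case (elim m)
        with real_rooted_norm_mono[of "P m" s "Im z" "Re z"] that show ?case by simp
      qed
      then have "cmod (poly (cpoly p) (Complex (Re z) s)) \<le> cmod (poly (cpoly p) z)"
        by (rule tendsto_le[OF F 2 1])
      with \<open>poly (cpoly p) z = 0\<close> show ?thesis by simp
    qed
    then have "(\<lambda>s. Complex (Re z) s) ` {0..Im z} \<subseteq> {w. poly (cpoly p) w = 0}"
      by auto
    moreover have "infinite ((\<lambda>s. Complex (Re z) s) ` {0..Im z})"
      using \<open>Im z > 0\<close> by (subst finite_image_iff) (auto simp: inj_on_def infinite_Icc)
    ultimately show False
      using poly_roots_finite[of "cpoly p"] \<open>p \<noteq> 0\<close> finite_subset by auto
  qed
  then show ?thesis unfolding only_real_zeros_iff_upper by blast
qed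

text \<open>The logarithmic derivative is \<open>\<Sum> 1/(z - a\<^sub>i)\<close> over the zeros \<open>a\<^sub>i\<close>; if none of them lies in the
  upper half-plane and \<open>z\<close> does, each summand has negative imaginary part.\<close>

lemma log_deriv_upper:
  fixes f :: "complex poly"
  assumes "\<And>w. Im w > 0 \<Longrightarrow> poly f w \<noteq> 0" "Im z > 0"
  shows "Im (poly (pderiv f) z / poly f z) \<le> 0"
    and "degree f > 0 \<Longrightarrow> Im (poly (pderiv f) z / poly f z) < 0"
proof -
  have "Im (poly (pderiv f) z / poly f z) \<le> 0 \<and>
      (degree f > 0 \<longrightarrow> Im (poly (pderiv f) z / poly f z) < 0)"
    using assms(1)
  proof (induction "degree f" arbitrary: f)
    case 0
    then have "pderiv f = 0" by (simp add: pderiv_eq_0_iff)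
    with 0 show ?case by simp
  next
    case (Suc n)
    have "\<not> constant (poly f)"
      using Suc by (simp add: constant_degree)
    then obtain a where a: "poly f a = 0"
      using fundamental_theorem_of_algebra by blast
    then obtain r where r: "f = [:- a, 1:] * r"
      by (auto simp: poly_eq_0_iff_dvd elim: dvdE)
    have "r \<noteq> 0" using Suc r by auto
    have "degree f = Suc (degree r)"
      unfolding r using \<open>r \<noteq> 0\<close> by (subst degree_mult_eq) auto
    then have "n = degree r" using Suc by simp
    moreover have rnz: "poly r w \<noteq> 0" if "Im w > 0" for w
      using Suc.prems[OF that] r by auto
    ultimately have "Im (poly (pderiv r) z / poly r z) \<le> 0"
      using Suc.hyps(1)[of r] by blast
    moreover have "Im a \<le> 0" using a Suc.prems[of a] by force
    then have *: "Im (z - a) > 0" using assms(2) by simp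
    then have "z - a \<noteq> 0" by auto
    then have "Im (1 / (z - a)) < 0"
      using * by (simp add: Im_divide divide_neg_pos sum_power2_gt_zero_iff complex_eq_iff)
    moreover have "poly (pderiv f) z = poly r z + (z - a) * poly (pderiv r) z"
      "poly f z = (z - a) * poly r z"
      unfolding r pderiv_mult by (simp_all add: pderiv_pCons algebra_simps)
    then have "poly (pderiv f) z / poly f z = 1 / (z - a) + poly (pderiv r) z / poly r z"
      using \<open>z - a \<noteq> 0\<close> rnz[OF assms(2)] by (simp add: add_divide_distrib)
    ultimately show ?case by simp
  qed
  then show "Im (poly (pderiv f) z / poly f z) \<le> 0"
    and "degree f > 0 \<Longrightarrow> Im (poly (pderiv f) z / poly f z) < 0" by auto
qed

lemma only_real_zeros_pderiv:
  assumes "only_real_zeros p"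
  shows "only_real_zeros (pderiv p)"
proof (cases "degree p = 0")
  case True
  then show ?thesis by (simp add: pderiv_eq_0_iff[symmetric])
next
  case False
  then have "p \<noteq> 0" by auto
  then have nz: "poly (cpoly p) w \<noteq> 0" if "Im w > 0" for w
    using only_real_zerosD[OF assms] that by simp
  have "poly (cpoly (pderiv p)) z \<noteq> 0" if "Im z > 0" for z
    using log_deriv_upper(2)[of "cpoly p", OF nz that] False by (auto simp: cpoly_pderiv)
  then show ?thesis unfolding only_real_zeros_iff_upper by blast
qed

lemma only_real_zeros_higher_pderiv:
  "only_real_zeros p \<Longrightarrow> only_real_zeros ((pderiv ^^ n) p)"
  by (induction n) (simp_all add: only_real_zeros_pderiv)

lemma only_real_zeros_if_card_roots:
  assumes "finite S" "card S \<ge> degree p" "\<And>x. x \<in> S \<Longrightarrow> poly p x = 0"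
  shows "only_real_zeros p"
proof (cases "p = 0")
  case False
  have "z \<in> \<real>" if "poly (cpoly p) z = 0" for z
  proof (rule ccontr)
    assume "z \<notin> \<real>"
    then have "card (insert z (of_real ` S)) = Suc (card S)"
      using assms(1) by (subst card_insert_disjoint) (auto simp: card_image inj_on_def)
    moreover have "card (insert z (of_real ` S)) \<le> card {z. poly (cpoly p) z = 0}"
      using False that assms by (intro card_mono poly_roots_finite) auto
    moreover have "card {z. poly (cpoly p) z = 0} \<le> degree (cpoly p)"
      using False by (intro card_poly_roots_bound) simp
    ultimately show False using assms(2) by simp
  qed
  then show ?thesis by (simp add: only_real_zeros_def)
qed simp

text \<open>The limit changes sign at a simple zero, and the sign at two fixed nearby points is inherited by
  all polynomials close to it.\<close>

lemma simple_real_zero_persists: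
  fixes P :: "'b \<Rightarrow> real poly"
  assumes conv: "\<And>x. ((\<lambda>m. poly (P m) x) \<longlongrightarrow> poly p x) F"
    and root: "poly p a = 0" and simple: "poly (pderiv p) a \<noteq> 0" and "\<eta> > 0"
  shows "eventually (\<lambda>m. \<exists>x. \<bar>x - a\<bar> < \<eta> \<and> poly (P m) x = 0) F"
proof -
  have main: "eventually (\<lambda>m. \<exists>x. \<bar>x - a\<bar> < \<eta> \<and> poly (P m) x = 0) F"
    if conv: "\<And>x. ((\<lambda>m. poly (P m) x) \<longlongrightarrow> poly p x) F"
      and root: "poly p a = 0" and pos: "poly (pderiv p) a > 0" for P :: "'b \<Rightarrow> real poly" and p
  proof -
    have D: "DERIV (poly p) a :> poly (pderiv p) a" by simp
    obtain d1 where d1: "d1 > 0" "\<And>h. 0 < h \<Longrightarrow> h < d1 \<Longrightarrow> poly p a < poly p (a + h)"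
      using DERIV_pos_inc_right[OF D pos] by blast
    obtain d2 where d2: "d2 > 0" "\<And>h. 0 < h \<Longrightarrow> h < d2 \<Longrightarrow> poly p (a - h) < poly p a"
      using DERIV_pos_inc_left[OF D pos] by blast
    define h where "h = min (min d1 d2) \<eta> / 2"
    have h: "0 < h" "h < d1" "h < d2" "h < \<eta>"
      using d1(1) d2(1) \<open>\<eta> > 0\<close> by (auto simp: h_def)
    have "eventually (\<lambda>m. poly (P m) (a + h) > 0) F"
      using order_tendstoD(1)[OF conv, of 0] d1(2)[of h] h root by simp
    moreover have "eventually (\<lambda>m. poly (P m) (a - h) < 0) F"
      using order_tendstoD(2)[OF conv, of _ 0] d2(2)[of h] h root by simp
    ultimately show ?thesis
    proof eventually_elim
      case (elim m)
      then obtain x where "a - h < x" "x < a + h" "poly (P m) x = 0"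
        using poly_IVT_pos[of "a - h" "a + h" "P m"] h by auto
      with h show ?case by (intro exI[of _ x]) auto
    qed
  qed
  show ?thesis
  proof (cases "poly (pderiv p) a > 0")
    case True
    then show ?thesis using main[of P p] conv root by blast
  next
    case False
    have "eventually (\<lambda>m. \<exists>x. \<bar>x - a\<bar> < \<eta> \<and> poly (- P m) x = 0) F"
      using False simple root conv
      by (intro main[of "\<lambda>m. - P m" "- p"]) (auto simp: pderiv_minus intro!: tendsto_intros)
    then show ?thesis by simp
  qed
qed

text \<open>Around distinct simple zeros one chooses disjoint intervals; each keeps a real zero, and there
  are as many of them as the degree allows.\<close>

lemma nondegenerate_zeros_perturb:
  assumes conv: "coeff_lim P p F" and deg: "\<And>m. degree (P m) \<le> degree p"
    and S: "finite S" "card S = degree p" "\<And>x. x \<in> S \<Longrightarrow> poly p x = 0 \<and> poly (pderiv p) x \<noteq> 0"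
  shows "eventually (\<lambda>m. only_real_zeros (P m)) F"
proof -
  obtain \<eta> where \<eta>: "\<eta> > 0" "\<And>x y. x \<in> S \<Longrightarrow> y \<in> S \<Longrightarrow> x \<noteq> y \<Longrightarrow> \<eta> \<le> \<bar>x - y\<bar>"
  proof -
    \<comment> \<open>the element 1 only keeps the set nonempty when there are no two distinct zeros\<close>
    let ?D = "insert 1 ((\<lambda>(x, y). \<bar>x - y\<bar>) ` {(x, y). x \<in> S \<and> y \<in> S \<and> x \<noteq> y})"
    have "finite {(x, y). x \<in> S \<and> y \<in> S \<and> x \<noteq> y}"
      by (rule finite_subset[of _ "S \<times> S"]) (auto simp: S(1))
    then have fin: "finite ?D" by simp
    have "Min ?D > 0" using fin by (subst Min_gr_iff) auto
    moreover have "Min ?D \<le> \<bar>x - y\<bar>" if "x \<in> S" "y \<in> S" "x \<noteq> y" for x y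
      using fin that by (intro Min_le) force+
    ultimately show ?thesis using that by blast
  qed
  have "((\<lambda>m. poly (P m) x) \<longlongrightarrow> poly p x) F" for x
    by (rule coeff_lim_poly[OF conv deg]) simp
  then have "eventually (\<lambda>m. \<exists>x. \<bar>x - a\<bar> < \<eta> / 2 \<and> poly (P m) x = 0) F" if "a \<in> S" for a
    using S(3)[OF that] \<eta>(1) by (intro simple_real_zero_persists) auto
  then have "eventually (\<lambda>m. \<forall>a\<in>S. \<exists>x. \<bar>x - a\<bar> < \<eta> / 2 \<and> poly (P m) x = 0) F"
    using S(1) by (simp add: eventually_ball_finite)
  then show ?thesis
  proof eventually_elim
    case (elim m)
    then obtain g where g: "\<And>a. a \<in> S \<Longrightarrow> \<bar>g a - a\<bar> < \<eta> / 2 \<and> poly (P m) (g a) = 0"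
      by metis
    have "inj_on g S"
    proof (rule inj_onI, rule ccontr)
      fix a b assume ab: "a \<in> S" "b \<in> S" "g a = g b" "a \<noteq> b"
      then have "\<eta> \<le> \<bar>a - b\<bar>" using \<eta>(2) by blast
      with g[OF ab(1)] g[OF ab(2)] ab(3) show False by linarith
    qed
    then show ?case
      using g S deg[of m] by (intro only_real_zeros_if_card_roots[of "g ` S"]) (auto simp: card_image)
  qed
qed

text \<open>As many distinct zeros as the degree leave no room for a multiple one: dividing by \<open>X - x\<close> would
  leave a polynomial of smaller degree with the same set of zeros.\<close>

lemma only_real_zeros_perturb:
  assumes conv: "coeff_lim P p F" and deg: "\<And>m. degree (P m) \<le> degree p"
    and S: "finite S" "card S = degree p" "\<And>x. x \<in> S \<Longrightarrow> poly p x = 0" and "p \<noteq> 0"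
  shows "eventually (\<lambda>m. only_real_zeros (P m)) F"
proof -
  have "poly (pderiv p) x \<noteq> 0" if "x \<in> S" for x
  proof
    assume "poly (pderiv p) x = 0"
    obtain r where r: "p = [:- x, 1:] * r"
      using S(3)[OF \<open>x \<in> S\<close>] by (auto simp: poly_eq_0_iff_dvd elim: dvdE)
    have "r \<noteq> 0" using r \<open>p \<noteq> 0\<close> by auto
    have deg: "degree p = Suc (degree r)"
      unfolding r using \<open>r \<noteq> 0\<close> by (subst degree_mult_eq) auto
    have "poly (pderiv p) x = poly r x"
      unfolding r pderiv_mult by (simp add: pderiv_pCons)
    with \<open>poly (pderiv p) x = 0\<close> S(3) have "poly r y = 0" if "y \<in> S" for y
      using that unfolding r by (cases "y = x") auto
    then have "card S \<le> card {y. poly r y = 0}"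
      using \<open>r \<noteq> 0\<close> by (intro card_mono poly_roots_finite) auto
    also have "\<dots> \<le> degree r" by (rule card_poly_roots_bound) fact
    finally show False using deg S(2) by simp
  qed
  with S show ?thesis by (intro nondegenerate_zeros_perturb[OF conv deg]) auto
qed

lemma simple_real_zeros_card:
  assumes "only_simple_real_zeros p" "p \<noteq> 0"
  shows "card {x. poly p x = 0} = degree p"
proof -
  let ?Z = "{z. poly (cpoly p) z = 0}"
  have "rsquarefree (cpoly p)"
    using assms by (auto simp: rsquarefree_def only_simple_real_zeros_def order_root)
  then have *: "smult (lead_coeff (cpoly p)) (\<Prod>z\<in>?Z. [:- z, 1:]) = cpoly p"
    by (rule complex_poly_decompose_rsquarefree)
  have "degree (\<Prod>z\<in>?Z. [:- z, 1:]) = card ?Z"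
    by (subst degree_prod_sum_eq) auto
  moreover have "lead_coeff (cpoly p) \<noteq> 0"
    unfolding leading_coeff_0_iff using assms(2) by simp
  ultimately have "degree p = card ?Z"
    using arg_cong[OF *, of degree] unfolding degree_smult_eq by simp
  moreover have "?Z = of_real ` {x. poly p x = 0}"
    using assms(1) by (fastforce simp: only_simple_real_zeros_def elim!: Reals_cases)
  ultimately show ?thesis by (simp add: card_image inj_on_def)
qed

lemma simple_real_zeros_perturb:
  assumes "only_simple_real_zeros p" "p \<noteq> 0"
    and "coeff_lim P p F" "\<And>m. degree (P m) \<le> degree p"
  shows "eventually (\<lambda>m. only_real_zeros (P m)) F"
  using assms(2) simple_real_zeros_card[OF assms(1,2)]
  by (intro only_real_zeros_perturb[OF assms(3,4), of "{x. poly p x = 0}"])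
    (auto intro: poly_roots_finite)

section \<open>Constraints from simple zeros of the basis\<close>

lemma degree_comb_le:
  assumes "simple_set q"
  shows "degree (\<Sum>k\<le>n. smult (a k) (q k)) \<le> n"
  using assms by (intro degree_sum_le) (auto simp: simple_set_def)

lemma simple_zeros_add_small:
  assumes "only_simple_real_zeros p" "p \<noteq> 0" "degree r \<le> degree p"
  shows "\<exists>\<delta>>0. only_real_zeros (p + smult \<delta> r)"
proof -
  have "coeff_lim (\<lambda>\<delta>. p + smult \<delta> r) (p + smult 0 r) (at_right 0)"
    by (intro coeff_lim_add coeff_lim_const coeff_lim_smult tendsto_ident_at)
  then have "eventually (\<lambda>\<delta>. only_real_zeros (p + smult \<delta> r)) (at_right 0)"
    using assms by (intro simple_real_zeros_perturb[of p]) (auto intro!: degree_add_le)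
  moreover have "eventually (\<lambda>\<delta>::real. \<delta> > 0) (at_right 0)"
    by (simp add: eventually_at_right_less)
  ultimately have "eventually (\<lambda>\<delta>. \<delta> > 0 \<and> only_real_zeros (p + smult \<delta> r)) (at_right 0)"
    by eventually_elim simp
  then show ?thesis
    using eventually_happens'[OF trivial_limit_at_right_real] by blast
qed

lemma multiplier_sequenceD:
  "multiplier_sequence q \<gamma> \<Longrightarrow> only_real_zeros (\<Sum>k\<le>n. smult (a k) (q k)) \<Longrightarrow>
    only_real_zeros (\<Sum>k\<le>n. smult (a k * \<gamma> k) (q k))"
  by (auto simp: multiplier_sequence_def)

lemma smult_sum_right: "smult c (\<Sum>i\<in>A. f i) = (\<Sum>i\<in>A. smult c (f i))"
  by (induction A rule: infinite_finite_induct) (simp_all add: smult_add_right)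

text \<open>The polynomial \<open>q m + \<delta> r\<close> is real-rooted for every \<open>r\<close> of degree at most \<open>m\<close> and small
  \<open>\<delta> > 0\<close>. The multiplier kills the leading term \<open>q m\<close>, so the image of an arbitrary \<open>r\<close> remains.\<close>

lemma vanishing_multiplier:
  assumes q: "simple_set q" and simple: "only_simple_real_zeros (q m)"
    and MS: "multiplier_sequence q \<gamma>" and "\<gamma> m = 0"
  shows "only_real_zeros (\<Sum>k<m. smult (a k * \<gamma> k) (q k))"
proof -
  have "degree (\<Sum>k<m. smult (a k) (q k)) \<le> m"
    using q by (intro degree_sum_le) (auto simp: simple_set_def)
  then obtain \<delta> where \<delta>: "\<delta> > 0"
      and RR: "only_real_zeros (q m + smult \<delta> (\<Sum>k<m. smult (a k) (q k)))"
    using simple_zeros_add_small[OF simple, of "\<Sum>k<m. smult (a k) (q k)"] q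
    by (auto simp: simple_set_def)
  let ?b = "\<lambda>k. if k = m then 1 else \<delta> * a k"
  have split: "(\<Sum>k\<le>m. smult (c k) (q k)) = smult (c m) (q m) + (\<Sum>k<m. smult (c k) (q k))" for c
    by (simp flip: lessThan_Suc_atMost add: add.commute)
  have "(\<Sum>k\<le>m. smult (?b k) (q k)) = q m + smult \<delta> (\<Sum>k<m. smult (a k) (q k))"
    by (simp add: split smult_sum_right)
  with RR have "only_real_zeros (\<Sum>k\<le>m. smult (?b k * \<gamma> k) (q k))"
    using MS by (intro multiplier_sequenceD) simp_all
  also have "(\<Sum>k\<le>m. smult (?b k * \<gamma> k) (q k)) = smult \<delta> (\<Sum>k<m. smult (a k * \<gamma> k) (q k))"
    using \<open>\<gamma> m = 0\<close> by (simp add: split smult_sum_right mult.assoc)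
  finally show ?thesis using \<delta> by simp
qed

lemma sum_two_terms:
  fixes q :: "nat \<Rightarrow> real poly"
  assumes "j < k" "k \<le> n"
  shows "(\<Sum>i\<le>n. smult (if i = j then b else if i = k then c else 0) (q i)) =
    smult b (q j) + smult c (q k)"
proof -
  have "(\<Sum>i\<le>n. smult (if i = j then b else if i = k then c else 0) (q i)) =
      (\<Sum>i\<in>{j, k}. smult (if i = j then b else if i = k then c else 0) (q i))"
    using assms by (intro sum.mono_neutral_right) auto
  then show ?thesis using assms by simp
qed

lemma multiplier_sequence_two_terms:
  assumes "multiplier_sequence q \<gamma>" "j < k"
    and "only_real_zeros (smult b (q j) + smult c (q k))"
  shows "only_real_zeros (smult (b * \<gamma> j) (q j) + smult (c * \<gamma> k) (q k))"
proof -
  let ?a = "\<lambda>i. if i = j then b else if i = k then c else 0"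
  have "only_real_zeros (\<Sum>i\<le>k. smult (?a i * \<gamma> i) (q i))"
    using assms by (intro multiplier_sequenceD) (simp_all add: sum_two_terms)
  also have "(\<Sum>i\<le>k. smult (?a i * \<gamma> i) (q i)) =
      (\<Sum>i\<le>k. smult (if i = j then b * \<gamma> j else if i = k then c * \<gamma> k else 0) (q i))"
    by (intro sum.cong) auto
  finally show ?thesis using assms by (simp add: sum_two_terms)
qed

text \<open>Differentiating \<open>j = degree g\<close> times turns \<open>b g\<close> into a constant, and the Laguerre inequality
  becomes linear in \<open>b\<close>.\<close>

lemma real_rooted_pencil_bound:
  assumes "degree g = j" "only_real_zeros (f + smult b g)"
  shows "b * (fact j * lead_coeff g * poly ((pderiv ^^ (j + 2)) f) x) \<le>
    (poly ((pderiv ^^ (j + 1)) f) x)\<^sup>2 - poly ((pderiv ^^ j) f) x * poly ((pderiv ^^ (j + 2)) f) x"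
proof -
  have g: "(pderiv ^^ j) g = [:fact j * lead_coeff g:]"
  proof (rule poly_eqI)
    fix n show "coeff ((pderiv ^^ j) g) n = coeff [:fact j * lead_coeff g:] n"
      using assms(1) by (cases n) (auto simp: coeff_higher_pderiv pochhammer_fact coeff_eq_0)
  qed
  let ?h = "(pderiv ^^ j) (f + smult b g)"
  have h: "?h = (pderiv ^^ j) f + [:b * (fact j * lead_coeff g):]"
    by (simp add: higher_pderiv_add higher_pderiv_smult g)
  have "only_real_zeros ?h" by (rule only_real_zeros_higher_pderiv) fact
  from laguerre_inequality[OF this, of x] show ?thesis
    unfolding h by (simp add: pderiv_add algebra_simps)
qed

text \<open>The linear inequality of \<open>real_rooted_pencil_bound\<close> has a nonzero coefficient at some point, so
  it cannot hold for all \<open>b\<close>.\<close>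

lemma nonreal_pencil_exists:
  assumes "degree g = j" "g \<noteq> 0" "j + 2 \<le> degree f"
  shows "\<exists>b. \<not> only_real_zeros (f + smult b g)"
proof (rule ccontr)
  assume *: "\<not> ?thesis"
  obtain d where d: "degree f = d + (j + 2)"
    using assms(3) by (metis le_add_diff_inverse2)
  then have "coeff f (d + (j + 2)) \<noteq> 0"
    by (metis add_gr_0 coeff_0 degree_0 leading_coeff_neq_0 less_numeral_extra(3) zero_less_numeral)
  then have "coeff ((pderiv ^^ (j + 2)) f) d \<noteq> 0"
    unfolding coeff_higher_pderiv by (auto simp: pochhammer_eq_0_iff simp flip: of_nat_Suc)
  then have "(pderiv ^^ (j + 2)) f \<noteq> 0" by (metis coeff_0)
  then obtain x where x: "poly ((pderiv ^^ (j + 2)) f) x \<noteq> 0"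
    using poly_all_0_iff_0 by blast
  define s where "s = fact j * lead_coeff g * poly ((pderiv ^^ (j + 2)) f) x"
  define M where "M = (poly ((pderiv ^^ (j + 1)) f) x)\<^sup>2 -
      poly ((pderiv ^^ j) f) x * poly ((pderiv ^^ (j + 2)) f) x"
  have "s \<noteq> 0" using x assms(2) by (simp add: s_def)
  have "(M + 1) / s * s \<le> M"
    unfolding s_def M_def using * by (intro real_rooted_pencil_bound[OF assms(1)]) blast
  with \<open>s \<noteq> 0\<close> show False by simp
qed

text \<open>The set of \<open>b\<close> for which \<open>q (k + 2) + b q k\<close> is real-rooted contains some \<open>b > 0\<close> because the
  zeros of \<open>q (k + 2)\<close> are simple, is bounded above because the leading coefficients are positive,
  and is mapped into itself by multiplication with \<open>\<gamma> k / \<gamma> (k + 2)\<close>.\<close>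

lemma abs_multiplier_le_two_steps:
  assumes q: "simple_set q" and simple: "\<And>k. only_simple_real_zeros (q k)"
    and pos: "\<And>k. lead_coeff (q k) > 0"
    and MS: "multiplier_sequence q \<gamma>"
    and nz: "\<gamma> (k + 2) \<noteq> 0" and sgn: "\<gamma> k * \<gamma> (k + 2) \<ge> 0"
  shows "\<bar>\<gamma> k\<bar> \<le> \<bar>\<gamma> (k + 2)\<bar>"
proof (rule ccontr)
  assume *: "\<not> ?thesis"
  define r where "r = \<gamma> k / \<gamma> (k + 2)"
  have "r = \<bar>\<gamma> k\<bar> / \<bar>\<gamma> (k + 2)\<bar>"
    using sgn unfolding r_def by (auto simp: zero_le_mult_iff abs_if divide_simps)
  then have "r > 1" using * nz by simp
  have deg: "degree (q i) = i" "q i \<noteq> 0" for i using q by (auto simp: simple_set_def)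
  have step: "only_real_zeros (q (k + 2) + smult (r * b) (q k))"
    if "only_real_zeros (q (k + 2) + smult b (q k))" for b
  proof -
    have "only_real_zeros (smult (b * \<gamma> k) (q k) + smult (1 * \<gamma> (k + 2)) (q (k + 2)))"
      using that by (intro multiplier_sequence_two_terms[OF MS]) (auto simp: add.commute)
    also have "\<dots> = smult (\<gamma> (k + 2)) (q (k + 2) + smult (r * b) (q k))"
      using nz by (simp add: smult_add_right r_def mult.commute)
    finally show ?thesis using nz by simp
  qed
  obtain b where "b > 0" and b: "only_real_zeros (q (k + 2) + smult b (q k))"
    using simple_zeros_add_small[OF simple[of "k + 2"], of "q k"] deg by auto
  have iter: "only_real_zeros (q (k + 2) + smult (r ^ n * b) (q k))" for n
    by (induction n) (use b step in \<open>auto simp: mult.assoc\<close>)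
  let ?f = "q (k + 2)"
  define s where "s = fact k * lead_coeff (q k) * poly ((pderiv ^^ (k + 2)) ?f) 0"
  define M where "M = (poly ((pderiv ^^ (k + 1)) ?f) 0)\<^sup>2 -
      poly ((pderiv ^^ k) ?f) 0 * poly ((pderiv ^^ (k + 2)) ?f) 0"
  have "poly ((pderiv ^^ (k + 2)) ?f) 0 = fact (k + 2) * lead_coeff ?f"
    unfolding poly_0_coeff_0 coeff_higher_pderiv by (simp add: pochhammer_fact deg)
  then have "s > 0" using pos by (simp add: s_def)
  have "r ^ n * b * s \<le> M" for n
    unfolding s_def M_def using iter[of n] deg by (intro real_rooted_pencil_bound) auto
  moreover obtain n where "r ^ n > M / (b * s)"
    using real_arch_pow[OF \<open>r > 1\<close>] by blast
  then have "M < r ^ n * (b * s)"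
    using \<open>b > 0\<close> \<open>s > 0\<close> by (subst (asm) pos_divide_less_eq) auto
  ultimately show False by (metis mult.assoc not_less)
qed

section \<open>Reduction to the monomial basis\<close>

text \<open>The diagonal operator \<open>x\<^sup>k \<mapsto> \<gamma> k x\<^sup>k\<close>.\<close>

definition hadamard :: "(nat \<Rightarrow> real) \<Rightarrow> real poly \<Rightarrow> real poly" where
  "hadamard \<gamma> p = (\<Sum>k\<le>degree p. monom (\<gamma> k * coeff p k) k)"

lemma coeff_hadamard [simp]: "coeff (hadamard \<gamma> p) i = \<gamma> i * coeff p i"
  by (auto simp: hadamard_def coeff_sum coeff_eq_0)

lemma degree_hadamard_le: "degree (hadamard \<gamma> p) \<le> degree p"
  by (rule degree_le) (simp add: coeff_eq_0)

text \<open>In \<open>\<epsilon>\<^sup>k q\<^sub>k(x/\<epsilon>)\<close> the coefficient of \<open>x\<^sup>i\<close> carries the factor \<open>\<epsilon>\<^sup>k\<^sup>-\<^sup>i\<close>, so only the leading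
  term survives.\<close>

lemma coeff_lim_rescaled:
  assumes q: "simple_set q"
  shows "coeff_lim
    (\<lambda>\<epsilon>. pcompose (\<Sum>k\<le>n. smult (a k * \<epsilon> ^ k / lead_coeff (q k)) (q k)) [:0, 1 / \<epsilon>:])
    (\<Sum>k\<le>n. monom (a k) k) (at_right 0)"
proof -
  have "coeff_lim (\<lambda>\<epsilon>. pcompose (smult (a k * \<epsilon> ^ k / lead_coeff (q k)) (q k)) [:0, 1 / \<epsilon>:])
      (monom (a k) k) (at_right 0)" for k
    unfolding coeff_lim_def
  proof
    fix i
    have deg: "degree (q k) = k" "q k \<noteq> 0" using q by (auto simp: simple_set_def)
    then have lc: "coeff (q k) k \<noteq> 0" using leading_coeff_0_iff[of "q k"] by simp
    let ?c = "\<lambda>\<epsilon>. a k * \<epsilon> ^ (k - i) * coeff (q k) i / lead_coeff (q k)"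
    have 1: "((\<lambda>\<epsilon>. ?c \<epsilon>) \<longlongrightarrow> ?c 0) (at_right 0)"
      by (intro tendsto_intros) (simp add: deg lc)
    have 2: "?c 0 = coeff (monom (a k) k) i"
      using deg lc by (cases i k rule: linorder_cases) (auto simp: coeff_eq_0)
    have 3: "eventually (\<lambda>\<epsilon>. coeff (pcompose (smult (a k * \<epsilon> ^ k / lead_coeff (q k)) (q k))
        [:0, 1 / \<epsilon>:]) i = ?c \<epsilon>) (at_right 0)"
      using eventually_at_right_less[of 0]
    proof eventually_elim
      case (elim \<epsilon>)
      show ?case
      proof (cases "i \<le> k")
        case True
        then have "\<epsilon> ^ k = \<epsilon> ^ (k - i) * \<epsilon> ^ i" by (simp flip: power_add)
        then show ?thesis
          using elim by (simp add: coeff_pcompose_linear power_divide)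
      qed (simp add: coeff_pcompose_linear coeff_eq_0 deg)
    qed
    show "((\<lambda>\<epsilon>. coeff (pcompose (smult (a k * \<epsilon> ^ k / lead_coeff (q k)) (q k))
        [:0, 1 / \<epsilon>:]) i) \<longlongrightarrow> coeff (monom (a k) k) i) (at_right 0)"
      using 1 unfolding tendsto_cong[OF 3] 2 .
  qed
  then show ?thesis unfolding pcompose_sum by (intro coeff_lim_sum)
qed

text \<open>A polynomial with simple real zeros stays real-rooted when the monomials \<open>x\<^sup>k\<close> are replaced by the
  nearby rescaled \<open>q\<^sub>k\<close>; there the multiplier property applies, since rescaling the variable does not
  affect real-rootedness, and the image converges.\<close>

lemma hadamard_real_rooted_if_simple:
  assumes q: "simple_set q" and MS: "multiplier_sequence q \<gamma>"
    and S: "finite S" "card S = degree p" "\<And>x. x \<in> S \<Longrightarrow> poly p x = 0" and "p \<noteq> 0"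
  shows "only_real_zeros (hadamard \<gamma> p)"
proof -
  let ?n = "degree p"
  \<comment> \<open>the combination before (G) and after (R) the substitution of x / epsilon for x\<close>
  define G where "G a \<epsilon> = (\<Sum>k\<le>?n. smult (a k * \<epsilon> ^ k / lead_coeff (q k)) (q k))" for a \<epsilon>
  define R where "R a \<epsilon> = pcompose (G a \<epsilon>) [:0, 1 / \<epsilon>:]" for a \<epsilon>
  have degR: "degree (R a \<epsilon>) \<le> ?n" for a \<epsilon>
  proof -
    have "degree (G a \<epsilon>) \<le> ?n"
      unfolding G_def by (rule degree_comb_le[OF q])
    then show ?thesis
      unfolding R_def using degree_pcompose_le[of "G a \<epsilon>" "[:0, 1 / \<epsilon>:]"]
      by (auto split: if_splits)
  qed
  have lim: "coeff_lim (R a) (\<Sum>k\<le>?n. monom (a k) k) (at_right 0)" for a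
    unfolding R_def G_def by (rule coeff_lim_rescaled[OF q])
  have "coeff_lim (R (coeff p)) p (at_right 0)"
    using lim[of "coeff p"] by (simp add: poly_as_sum_of_monoms)
  then have "eventually (\<lambda>\<epsilon>. only_real_zeros (R (coeff p) \<epsilon>)) (at_right 0)"
    by (rule only_real_zeros_perturb[OF _ degR S \<open>p \<noteq> 0\<close>])
  then have "eventually (\<lambda>\<epsilon>. only_real_zeros (R (\<lambda>k. \<gamma> k * coeff p k) \<epsilon>)) (at_right 0)"
    using eventually_at_right_less[of 0]
  proof eventually_elim
    case (elim \<epsilon>)
    then have "only_real_zeros (G (coeff p) \<epsilon>)"
      by (simp add: R_def only_real_zeros_pcompose_scale)
    from multiplier_sequenceD[OF MS this[unfolded G_def]]
    have "only_real_zeros (G (\<lambda>k. \<gamma> k * coeff p k) \<epsilon>)"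
      by (simp add: G_def mult_ac)
    with elim show ?case by (simp add: R_def only_real_zeros_pcompose_scale)
  qed
  then show ?thesis
    unfolding hadamard_def using only_real_zeros_closed[OF lim degR] by simp
qed

text \<open>The general case is reached by pulling the zeros apart: to the \<open>i\<close>-th zero in increasing order
  one adds \<open>\<epsilon> i\<close>.\<close>

lemma hadamard_real_rooted:
  assumes q: "simple_set q" and MS: "multiplier_sequence q \<gamma>" and RR: "only_real_zeros p"
  shows "only_real_zeros (hadamard \<gamma> p)"
proof (cases "p = 0")
  case False
  obtain c ys where p': "p = smult c (\<Prod>x\<leftarrow>ys. [:- x, 1:])"
    using real_rooted_factorization[OF RR] by blast
  define xs where "xs = sort ys"
  let ?n = "length xs"
  have "(\<Prod>x\<leftarrow>ys. [:- x, 1:]) = (\<Prod>x\<leftarrow>xs. [:- x, 1:])"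
    unfolding xs_def by (simp flip: prod_mset_prod_list)
  also have "\<dots> = (\<Prod>i\<leftarrow>[0..<?n]. [:- (xs ! i), 1:])"
    by (subst map_nth[of xs, symmetric]) (simp add: o_def del: map_nth)
  finally have p: "p = smult c (\<Prod>i\<leftarrow>[0..<?n]. [:- (xs ! i), 1:])"
    using p' by simp
  define P where "P \<epsilon> = smult c (\<Prod>i\<leftarrow>[0..<?n]. [:- (xs ! i + \<epsilon> * real i), 1:])" for \<epsilon>
  have "((\<lambda>\<epsilon>. - (xs ! i + \<epsilon> * real i)) \<longlongrightarrow> - (xs ! i + 0 * real i)) (at_right 0)" for i
    by (intro tendsto_intros)
  then have lim: "coeff_lim P p (at_right 0)"
    unfolding P_def p by (intro coeff_lim_smult tendsto_const coeff_lim_prod_list coeff_lim_linear) simp_all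
  have "c \<noteq> 0" using False p by auto
  have P: "P \<epsilon> = smult c (\<Prod>i\<in>{0..<?n}. [:- (xs ! i + \<epsilon> * real i), 1:])" for \<epsilon>
    unfolding P_def
      using prod.distinct_set_conv_list[of "[0..<?n]" "\<lambda>i. [:- (xs ! i + \<epsilon> * real i), 1:]"] by simp
  have degP: "degree (P \<epsilon>) = ?n" "P \<epsilon> \<noteq> 0" for \<epsilon>
  proof -
    show "degree (P \<epsilon>) = ?n" using \<open>c \<noteq> 0\<close> unfolding P
      by (simp add: degree_prod_sum_eq)
    show "P \<epsilon> \<noteq> 0" using \<open>c \<noteq> 0\<close> unfolding P by simp
  qed
  have had: "only_real_zeros (hadamard \<gamma> (P \<epsilon>))" if "\<epsilon> > 0" for \<epsilon>
  proof (rule hadamard_real_rooted_if_simple[OF q MS])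
    let ?g = "\<lambda>i. xs ! i + \<epsilon> * real i"
    have "?g i < ?g j" if "i < j" "j < ?n" for i j
      using that \<open>\<epsilon> > 0\<close> sorted_nth_mono[of xs i j]
      by (intro add_le_less_mono) (auto simp: xs_def)
    then have "inj_on ?g {0..<?n}"
      by (intro inj_onI) (metis atLeastLessThan_iff less_irrefl nat_neq_iff)
    then show "card (?g ` {0..<?n}) = degree (P \<epsilon>)"
      by (simp add: card_image degP)
    show "poly (P \<epsilon>) x = 0" if "x \<in> ?g ` {0..<?n}" for x
    proof -
      from that obtain i where "i < ?n" "x = ?g i" by auto
      then have "(\<Prod>j\<in>{0..<?n}. poly [:- ?g j, 1:] x) = 0"
        by (intro prod_zero) (auto intro!: bexI[of _ i])
      then show ?thesis by (simp add: P poly_prod)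
    qed
  qed (simp_all add: degP)
  have ev: "eventually (\<lambda>\<epsilon>. only_real_zeros (hadamard \<gamma> (P \<epsilon>))) (at_right 0)"
    using eventually_at_right_less[of 0] by eventually_elim (rule had)
  have limh: "coeff_lim (\<lambda>\<epsilon>. hadamard \<gamma> (P \<epsilon>)) (hadamard \<gamma> p) (at_right 0)"
    using lim by (auto simp: coeff_lim_def intro!: tendsto_intros)
  have degh: "degree (hadamard \<gamma> (P \<epsilon>)) \<le> ?n" for \<epsilon>
    using degree_hadamard_le degP by metis
  show ?thesis
    by (rule only_real_zeros_closed[OF limh degh _ ev]) simp
qed (simp add: hadamard_def)

section \<open>Log-concavity, signs and support of the multipliers\<close>

text \<open>After dividing by \<open>x\<^sup>i\<close> the Laguerre inequality for \<open>a + b x\<^sup>d\<close> fails at small \<open>s > 0\<close>: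
  near \<open>0\<close> the term \<open>p p''\<close> is of order \<open>s\<^sup>d\<^sup>-\<^sup>2\<close> and positive, while \<open>p'\<^sup>2\<close> is of order \<open>s\<^sup>2\<^sup>d\<^sup>-\<^sup>2\<close>.\<close>

lemma positive_two_term_not_real_rooted:
  assumes "a * b > 0" "d \<ge> 2"
  shows "\<not> only_real_zeros (monom a i + monom b (i + d))"
proof
  assume RR: "only_real_zeros (monom a i + monom b (i + d))"
  obtain e where d: "d = e + 2" using assms(2) by (metis le_add_diff_inverse2)
  let ?r = "[:a:] + monom b d"
  have "a \<noteq> 0" "b \<noteq> 0" using assms(1) by auto
  have "monom a i + monom b (i + d) = monom 1 i * ?r"
    by (simp add: distrib_left mult_monom flip: monom_0)
  moreover have "?r \<noteq> 0"
  proof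
    assume "?r = 0"
    then have "coeff ?r 0 = 0" by (simp only: coeff_0)
    then show False using d \<open>a \<noteq> 0\<close> by simp
  qed
  ultimately have r: "only_real_zeros ?r"
    using RR only_real_zeros_mult_iff[of "monom 1 i" ?r] by (simp add: monom_eq_0_iff)
  \<comment> \<open>small enough for \<open>b\<^sup>2 s\<^sup>d < a b\<close>, using \<open>s\<^sup>d \<le> s\<close>\<close>
  define s where "s = min 1 (a * b / (2 * b\<^sup>2))"
  have "a * b / (2 * b\<^sup>2) > 0"
    using assms(1) \<open>b \<noteq> 0\<close> by (intro divide_pos_pos) auto
  then have s: "s > 0" "s \<le> 1" "s \<le> a * b / (2 * b\<^sup>2)"
    by (auto simp: s_def)
  have "b\<^sup>2 * s ^ (e + 2) \<le> b\<^sup>2 * s"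
    using s power_decreasing[of 1 "e + 2" s] by (intro mult_left_mono) auto
  also have "\<dots> \<le> a * b / 2"
    using s(3) \<open>b \<noteq> 0\<close> by (simp add: field_simps)
  finally have small: "b\<^sup>2 * s ^ (e + 2) < a * b"
    using assms(1) by simp
  have "(a + b * s ^ (e + 2)) * (real (e + 2) * real (e + 1) * b * s ^ e) \<le>
      (real (e + 2) * b * s ^ (e + 1))\<^sup>2"
    using laguerre_inequality[OF r, of s]
    by (simp add: d pderiv_add pderiv_monom poly_monom pderiv_pCons algebra_simps)
  also have "\<dots> = (real (e + 2) * s ^ e) * (real (e + 2) * b\<^sup>2 * s ^ (e + 2))"
    by (simp add: power2_eq_square power_add algebra_simps)
  finally have "(real (e + 2) * s ^ e) * ((a + b * s ^ (e + 2)) * (real (e + 1) * b)) \<le>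
      (real (e + 2) * s ^ e) * (real (e + 2) * b\<^sup>2 * s ^ (e + 2))"
    by (simp add: mult_ac)
  moreover have "real (e + 2) * s ^ e > 0" using s by simp
  ultimately have "(a + b * s ^ (e + 2)) * (real (e + 1) * b) \<le> real (e + 2) * b\<^sup>2 * s ^ (e + 2)"
    by (rule mult_left_le_imp_le)
  then have "real (e + 1) * (a * b) \<le> b\<^sup>2 * s ^ (e + 2)"
    by (simp add: algebra_simps power2_eq_square)
  moreover have "1 * (a * b) \<le> real (e + 1) * (a * b)"
    using assms(1) by (intro mult_right_mono) auto
  ultimately show False using small by linarith
qed

lemma only_real_zeros_power: "only_real_zeros p \<Longrightarrow> only_real_zeros (p ^ n)"
  using only_real_zeros_prod_list[of "replicate n p"] by simp

lemma only_real_zeros_monom [simp]: "only_real_zeros (monom c n)"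
  by (simp add: monom_altdef only_real_zeros_power)

lemma quadratic_as_monoms: "[:a, b, c:] = monom a 0 + monom b 1 + monom c (2 :: nat)"
  by (simp add: monom_0 monom_Suc numeral_2_eq_2)

lemma only_real_zeros_monom_mult:
  "only_real_zeros (monom 1 k * p) \<Longrightarrow> only_real_zeros p"
  using only_real_zeros_mult_iff[of "monom 1 k" p]
  by (cases "p = 0") (auto simp: monom_eq_0_iff)

lemma quadratic_real_rooted_discriminant:
  assumes "only_real_zeros [:a, 2 * b, c:]"
  shows "a * c \<le> b\<^sup>2"
proof (cases "c = 0")
  case False
  have "(a + (- b / c) * (2 * b + (- b / c) * c)) * (2 * c) \<le> (2 * b + 2 * c * (- b / c))\<^sup>2"
    using laguerre_inequality[OF assms, of "- b / c"]
    by (simp add: pderiv_pCons algebra_simps)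
  moreover have "(a + (- b / c) * (2 * b + (- b / c) * c)) * (2 * c) = 2 * (a * c - b\<^sup>2)"
    "2 * b + 2 * c * (- b / c) = 0"
    using False by (simp_all add: field_simps power2_eq_square)
  ultimately show ?thesis by simp
qed simp

context
  fixes \<gamma> :: "nat \<Rightarrow> real"
  assumes had: "\<And>p. only_real_zeros p \<Longrightarrow> only_real_zeros (hadamard \<gamma> p)"
begin

text \<open>The multiplier turns \<open>x\<^sup>k(x\<^sup>2 - 1)\<close> into a binomial, which is real-rooted only if its two
  coefficients do not have the same strict sign.\<close>

lemma multipliers_two_steps_same_sign: "0 \<le> \<gamma> k * \<gamma> (k + 2)"
proof -
  have "[:-1, 1:] * [:1, 1:] = [:-1, 0, 1 :: real:]" by simp
  then have eq: "monom 1 k * ([:-1, 1:] * [:1, 1:]) = monom (-1) k + monom (1 :: real) (k + 2)"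
    by (simp only: quadratic_as_monoms distrib_left mult_monom) simp
  have "only_real_zeros (monom 1 k * ([:-1, 1:] * [:1, 1:]))"
    by (intro only_real_zeros_mult) auto
  then have "only_real_zeros (hadamard \<gamma> (monom (-1) k + monom 1 (k + 2)))"
    unfolding eq by (rule had)
  also have "hadamard \<gamma> (monom (-1) k + monom 1 (k + 2)) =
      monom (- \<gamma> k) k + monom (\<gamma> (k + 2)) (k + 2)"
    by (intro poly_eqI) simp
  finally have "\<not> - \<gamma> k * \<gamma> (k + 2) > 0"
    using positive_two_term_not_real_rooted by blast
  then show ?thesis by simp
qed

text \<open>Apply the multiplier to \<open>x\<^sup>k (1 + x)\<^sup>2\<close> and take the discriminant.\<close>

lemma multipliers_log_concave: "\<gamma> k * \<gamma> (k + 2) \<le> (\<gamma> (k + 1))\<^sup>2"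
proof -
  have "[:1, 1:] * [:1, 1:] = [:1, 2, 1 :: real:]" by simp
  then have eq: "monom 1 k * ([:1, 1:] * [:1, 1:]) =
      monom 1 k + monom 2 (k + 1) + monom (1 :: real) (k + 2)"
    by (simp only: quadratic_as_monoms distrib_left mult_monom) simp
  have "only_real_zeros (monom 1 k * ([:1, 1:] * [:1, 1:]))"
    by (intro only_real_zeros_mult) auto
  then have "only_real_zeros (hadamard \<gamma> (monom 1 k + monom 2 (k + 1) + monom 1 (k + 2)))"
    unfolding eq by (rule had)
  also have "hadamard \<gamma> (monom 1 k + monom 2 (k + 1) + monom 1 (k + 2)) =
      monom (\<gamma> k) k + monom (2 * \<gamma> (k + 1)) (k + 1) + monom (\<gamma> (k + 2)) (k + 2)"
    by (intro poly_eqI) simp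
  also have "\<dots> = monom 1 k * [:\<gamma> k, 2 * \<gamma> (k + 1), \<gamma> (k + 2):]"
    by (simp add: quadratic_as_monoms distrib_left mult_monom)
  finally have "only_real_zeros [:\<gamma> k, 2 * \<gamma> (k + 1), \<gamma> (k + 2):]"
    by (rule only_real_zeros_monom_mult)
  then show ?thesis by (rule quadratic_real_rooted_discriminant)
qed

text \<open>Across a gap, \<open>x\<^sup>i (1 + x)\<^sup>d\<^sup>-\<^sup>1 (1 \<plusminus> x)\<close> is mapped to \<open>\<gamma> i x\<^sup>i \<plusminus> \<gamma> (i + d) x\<^sup>i\<^sup>+\<^sup>d\<close>, and for one choice of
  the sign both coefficients have the same sign.\<close>

lemma multipliers_no_gap:
  assumes "\<gamma> i \<noteq> 0" "\<gamma> (i + d) \<noteq> 0" "d \<ge> 2"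
    and gap: "\<And>k. i < k \<Longrightarrow> k < i + d \<Longrightarrow> \<gamma> k = 0"
  shows False
proof -
  define u where "u = sgn (\<gamma> i * \<gamma> (i + d))"
  have "u \<noteq> 0" using assms by (simp add: u_def sgn_0_0)
  let ?f = "[:1, 1:] ^ (d - 1) * [:1, u:]"
  have f0: "coeff ?f 0 = 1" by (simp add: coeff_mult coeff_0_power)
  have degf: "degree ?f = d"
    using assms(3) \<open>u \<noteq> 0\<close> by (subst degree_mult_eq) (auto simp: degree_power_eq)
  have fd: "coeff ?f d = u"
  proof -
    have "coeff ?f d = lead_coeff ?f" using degf by simp
    also have "\<dots> = u" using \<open>u \<noteq> 0\<close> by (subst lead_coeff_mult) (simp add: lead_coeff_power)
    finally show ?thesis .
  qed
  have "only_real_zeros (monom 1 i * ?f)"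
  proof (intro only_real_zeros_mult)
    show "only_real_zeros ([:1, 1:] ^ (d - 1))"
      by (simp add: only_real_zeros_power)
  qed auto
  then have "only_real_zeros (hadamard \<gamma> (monom 1 i * ?f))" by (rule had)
  also have "hadamard \<gamma> (monom 1 i * ?f) = monom (\<gamma> i) i + monom (u * \<gamma> (i + d)) (i + d)"
  proof (rule poly_eqI)
    fix n
    consider "n < i" | "n = i" | "i < n" "n < i + d" | "n = i + d" | "n > i + d" by linarith
    then show "coeff (hadamard \<gamma> (monom 1 i * ?f)) n =
        coeff (monom (\<gamma> i) i + monom (u * \<gamma> (i + d)) (i + d)) n"
    proof cases
      case 5
      then have "coeff ?f (n - i) = 0" using degf by (intro coeff_eq_0) simp
      with 5 show ?thesis by (simp add: coeff_monom_mult)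
    qed (use f0 fd gap assms(3) in \<open>simp_all add: coeff_monom_mult\<close>)
  qed
  finally have "\<not> \<gamma> i * (u * \<gamma> (i + d)) > 0"
    using positive_two_term_not_real_rooted assms(3) by blast
  moreover have "\<gamma> i * (u * \<gamma> (i + d)) = \<bar>\<gamma> i * \<gamma> (i + d)\<bar>"
    by (simp add: u_def abs_sgn mult_ac)
  ultimately show False using assms by simp
qed

lemma multipliers_no_internal_zero:
  assumes "\<gamma> i \<noteq> 0" "\<gamma> k \<noteq> 0" "i < m" "m < k"
  shows "\<gamma> m \<noteq> 0"
proof
  assume "\<gamma> m = 0"
  let ?A = "{j. j < m \<and> \<gamma> j \<noteq> 0}"
  define i' where "i' = Max ?A"
  define k' where "k' = (LEAST k. m < k \<and> \<gamma> k \<noteq> 0)"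
  have "i' \<in> ?A" unfolding i'_def using assms by (intro Max_in) auto
  moreover have "\<gamma> j = 0" if "i' < j" "j < m" for j
    using that Max_ge[of ?A j] finite_subset[of ?A "{..<m}"] unfolding i'_def by fastforce
  moreover have "m < k'" "\<gamma> k' \<noteq> 0"
    using LeastI[of "\<lambda>k. m < k \<and> \<gamma> k \<noteq> 0" k] assms unfolding k'_def by auto
  moreover have "\<gamma> j = 0" if "m < j" "j < k'" for j
    using not_less_Least[of j "\<lambda>k. m < k \<and> \<gamma> k \<noteq> 0"] that unfolding k'_def by auto
  ultimately have "\<gamma> j = 0" if "i' < j" "j < k'" for j
    using that \<open>\<gamma> m = 0\<close> by (cases j m rule: linorder_cases) auto
  moreover have "i' < m" "\<gamma> i' \<noteq> 0" using \<open>i' \<in> ?A\<close> by auto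
  moreover have "k' - i' \<ge> 2" "i' + (k' - i') = k'"
    using \<open>i' < m\<close> \<open>m < k'\<close> by linarith+
  ultimately show False
    using multipliers_no_gap[of i' "k' - i'"] \<open>\<gamma> k' \<noteq> 0\<close> by metis
qed

end

text \<open>By \<open>vanishing_multiplier\<close> every combination of \<open>q j\<close> and \<open>q k\<close> would be real-rooted, which fails
  if the degrees differ by at least two.\<close>

lemma nonzero_multipliers_adjacent_below_zero:
  assumes q: "simple_set q" and simple: "\<And>k. only_simple_real_zeros (q k)"
    and MS: "multiplier_sequence q \<gamma>" and "\<gamma> m = 0" "j < k" "k < m" "\<gamma> j \<noteq> 0" "\<gamma> k \<noteq> 0"
  shows "k = Suc j"
proof (rule ccontr)
  assume "k \<noteq> Suc j"
  then have "degree (q j) = j" "q j \<noteq> 0" "j + 2 \<le> degree (q k)"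
    using q \<open>j < k\<close> by (auto simp: simple_set_def)
  then obtain b where "\<not> only_real_zeros (q k + smult b (q j))"
    using nonreal_pencil_exists by blast
  moreover have "only_real_zeros (q k + smult b (q j))"
  proof -
    let ?a = "\<lambda>i. if i = j then b / \<gamma> j else if i = k then 1 / \<gamma> k else 0"
    have "only_real_zeros (\<Sum>i<m. smult (?a i * \<gamma> i) (q i))"
      by (rule vanishing_multiplier) fact+
    also have "(\<Sum>i<m. smult (?a i * \<gamma> i) (q i)) = (\<Sum>i\<in>{j, k}. smult (?a i * \<gamma> i) (q i))"
      using assms by (intro sum.mono_neutral_right) auto
    also have "\<dots> = q k + smult b (q j)"
      using assms by simp
    finally show ?thesis .
  qed
  ultimately show False by contradiction
qed

lemma multiplier_support:
  assumes q: "simple_set q" and simple: "\<And>k. only_simple_real_zeros (q k)"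
    and MS: "multiplier_sequence q \<gamma>"
  obtains (two) i where "\<And>k. \<gamma> k \<noteq> 0 \<Longrightarrow> k = i \<or> k = Suc i"
  | (tail) r where "\<And>k. \<gamma> k \<noteq> 0 \<longleftrightarrow> r \<le> k"
proof (cases "\<exists>r. \<gamma> r \<noteq> 0")
  case False
  then show ?thesis using two[of 0] by simp
next
  case True
  define r where "r = (LEAST r. \<gamma> r \<noteq> 0)"
  have r: "\<gamma> r \<noteq> 0" unfolding r_def using True by (rule LeastI_ex)
  have below: "r \<le> k" if "\<gamma> k \<noteq> 0" for k unfolding r_def using that by (rule Least_le)
  show ?thesis
  proof (cases "\<exists>m\<ge>r. \<gamma> m = 0")
    case False
    then show ?thesis using tail[of r] below by blast
  next
    case True
    then obtain m where m: "m > r" "\<gamma> m = 0" using r by (metis le_neq_implies_less)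
    have "k = r \<or> k = Suc r" if "\<gamma> k \<noteq> 0" for k
    proof -
      have "k < m"
        using multipliers_no_internal_zero[OF hadamard_real_rooted[OF q MS] r that m(1)] m that
        by (metis linorder_neqE_nat)
      then show ?thesis
        using below[OF that] nonzero_multipliers_adjacent_below_zero[OF q simple MS m(2) _ _ r that]
        by force
    qed
    then show ?thesis by (rule two)
  qed
qed

section \<open>Moebius transforms and Jensen polynomials\<close>

text \<open>The polynomial \<open>(1 - \<xi> x)\<^sup>n p(x / (1 - \<xi> x))\<close>, for \<open>p\<close> of degree at most \<open>n\<close>.\<close>

definition moebius_poly :: "nat \<Rightarrow> real \<Rightarrow> real poly \<Rightarrow> real poly" where
  "moebius_poly n \<xi> p = (\<Sum>j\<le>n. monom (coeff p j) j * [:1, - \<xi>:] ^ (n - j))"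

lemma poly_moebius_poly:
  assumes "degree p \<le> n" "1 - of_real \<xi> * z \<noteq> 0"
  shows "poly (cpoly (moebius_poly n \<xi> p)) z =
    (1 - of_real \<xi> * z) ^ n * poly (cpoly p) (z / (1 - of_real \<xi> * z))"
proof -
  have pow: "cpoly ([:1, - \<xi>:] ^ k) = [:1, - of_real \<xi>:] ^ k" for k
    by (induction k) (simp_all add: one_pCons)
  have "poly (cpoly (moebius_poly n \<xi> p)) z =
      (\<Sum>j\<le>n. of_real (coeff p j) * z ^ j * (1 - of_real \<xi> * z) ^ (n - j))"
    unfolding moebius_poly_def cpoly_sum cpoly_mult pow
    by (simp add: poly_sum map_poly_monom poly_monom poly_power mult_ac)
  also have "\<dots> = (\<Sum>j\<le>n. (1 - of_real \<xi> * z) ^ n * (of_real (coeff p j) * (z / (1 - of_real \<xi> * z)) ^ j))"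
    using assms(2) by (intro sum.cong refl) (simp add: power_diff power_divide)
  also have "\<dots> = (1 - of_real \<xi> * z) ^ n * poly (cpoly p) (z / (1 - of_real \<xi> * z))"
    using assms(1) by (subst poly_eq_sum_le[of _ n]) (simp_all add: sum_distrib_left coeff_map_poly)
  finally show ?thesis .
qed

lemma Im_moebius_nonzero:
  assumes "Im z \<noteq> 0"
  shows "1 - of_real \<xi> * z \<noteq> 0" "Im (z / (1 - of_real \<xi> * z)) \<noteq> 0"
proof -
  show nz: "1 - of_real \<xi> * z \<noteq> 0"
    using assms by (cases "\<xi> = 0") (auto simp: complex_eq_iff)
  have "Im (z / (1 - of_real \<xi> * z)) = Im z / (cmod (1 - of_real \<xi> * z))\<^sup>2"
    by (simp add: Im_complex_div_eq_0 Im_divide cmod_power2 algebra_simps)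
  then show "Im (z / (1 - of_real \<xi> * z)) \<noteq> 0"
    using assms nz by simp
qed

lemma moebius_poly_real_rooted:
  assumes "only_real_zeros p" "degree p \<le> n"
  shows "only_real_zeros (moebius_poly n \<xi> p)"
proof (cases "p = 0")
  case False
  have "poly (cpoly (moebius_poly n \<xi> p)) z \<noteq> 0" if "Im z > 0" for z
    using Im_moebius_nonzero[of z \<xi>] that only_real_zerosD[OF assms(1) False]
    by (simp add: poly_moebius_poly assms(2))
  then show ?thesis unfolding only_real_zeros_iff_upper by blast
qed (simp add: moebius_poly_def)

text \<open>Up to the factor \<open>- \<xi>\<close>, the polar derivative \<open>n p + (a - x) p'\<close> with respect to the point
  \<open>a = - 1 / \<xi>\<close>; the normalization includes the ordinary derivative as \<open>\<xi> = 0\<close>.\<close>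

definition polar_deriv :: "nat \<Rightarrow> real \<Rightarrow> real poly \<Rightarrow> real poly" where
  "polar_deriv n \<xi> p = [:1, \<xi>:] * pderiv p - smult (\<xi> * real n) p"

lemma coeff_polar_deriv:
  "coeff (polar_deriv (Suc n) \<xi> p) j = real (Suc j) * coeff p (Suc j) - \<xi> * (real (Suc n) - real j) * coeff p j"
  by (cases j) (simp_all add: polar_deriv_def coeff_pderiv algebra_simps)

lemma degree_polar_deriv:
  assumes "degree p \<le> Suc n"
  shows "degree (polar_deriv (Suc n) \<xi> p) \<le> n"
proof (rule degree_le, intro allI impI)
  fix j assume "n < j"
  with assms show "coeff (polar_deriv (Suc n) \<xi> p) j = 0"
    unfolding coeff_polar_deriv by (cases "j = Suc n") (auto simp: coeff_eq_0)
qed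

lemma pderiv_sum: "pderiv (sum f A) = (\<Sum>i\<in>A. pderiv (f i))"
  using higher_pderiv_sum[of 1 f A] by simp

text \<open>A Moebius change of variable conjugates the polar derivative into the ordinary one.\<close>

lemma pderiv_moebius_poly:
  "pderiv (moebius_poly (Suc n) \<xi> p) = moebius_poly n \<xi> (polar_deriv (Suc n) \<xi> p)"
proof -
  let ?L = "[:1, - \<xi>:]"
  have D: "pderiv (monom (coeff p j) j * ?L ^ (Suc n - j)) =
      monom (real j * coeff p j) (j - 1) * ?L ^ (Suc n - j) -
      monom (\<xi> * (real (Suc n) - real j) * coeff p j) j * ?L ^ (n - j)" if "j \<le> Suc n" for j
  proof (cases "j = Suc n")
    case True
    then show ?thesis by (simp add: pderiv_monom)
  next
    case False
    then have "pderiv (?L ^ (Suc n - j)) = smult (- \<xi> * (real (Suc n) - real j)) (?L ^ (n - j))"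
    proof -
      have "pderiv (?L ^ Suc (n - j)) = smult (real (Suc (n - j))) (?L ^ (n - j)) * [:- \<xi>:]"
        by (simp only: pderiv_power_Suc) (simp add: pderiv_pCons)
      moreover have "Suc (n - j) = Suc n - j" "real (Suc (n - j)) = real (Suc n) - real j"
        using that False by (simp_all add: of_nat_diff)
      ultimately show ?thesis by (simp add: mult.commute)
    qed
    then show ?thesis
      unfolding pderiv_mult pderiv_monom by (simp add: smult_monom flip: mult_smult_left)
  qed
  have "pderiv (moebius_poly (Suc n) \<xi> p) =
      (\<Sum>j\<le>Suc n. monom (real j * coeff p j) (j - 1) * ?L ^ (Suc n - j)) -
      (\<Sum>j\<le>Suc n. monom (\<xi> * (real (Suc n) - real j) * coeff p j) j * ?L ^ (n - j))"
    unfolding moebius_poly_def pderiv_sum sum_subtractf[symmetric] by (intro sum.cong D refl) simp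
  also have "(\<Sum>j\<le>Suc n. monom (real j * coeff p j) (j - 1) * ?L ^ (Suc n - j)) =
      (\<Sum>j\<le>n. monom (real (Suc j) * coeff p (Suc j)) j * ?L ^ (n - j))"
    by (subst sum.atMost_Suc_shift) simp
  also have "(\<Sum>j\<le>Suc n. monom (\<xi> * (real (Suc n) - real j) * coeff p j) j * ?L ^ (n - j)) =
      (\<Sum>j\<le>n. monom (\<xi> * (real (Suc n) - real j) * coeff p j) j * ?L ^ (n - j))"
    by simp
  finally show ?thesis
    unfolding moebius_poly_def coeff_polar_deriv
    by (simp add: sum_subtractf[symmetric] left_diff_distrib[symmetric] diff_monom del: of_nat_Suc)
qed

text \<open>Real Moebius maps permute the nonreal numbers, so this is the corresponding statement for the
  ordinary derivative, transported by \<open>pderiv_moebius_poly\<close>.\<close>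

lemma polar_derivative_real_rooted:
  assumes RR: "only_real_zeros p" and deg: "degree p \<le> Suc n"
  shows "only_real_zeros (polar_deriv (Suc n) \<xi> p)" (is "only_real_zeros ?r")
proof -
  let ?M = "moebius_poly n \<xi> ?r"
  have M: "only_real_zeros ?M"
    unfolding pderiv_moebius_poly[symmetric]
    by (intro only_real_zeros_pderiv moebius_poly_real_rooted assms)
  have eq: "poly (cpoly ?r) z = 0 \<longleftrightarrow> poly (cpoly ?M) (z / (1 + of_real \<xi> * z)) = 0"
    "Im (z / (1 + of_real \<xi> * z)) \<noteq> 0" if "Im z \<noteq> 0" for z
  proof -
    define u where "u = z / (1 + of_real \<xi> * z)"
    have nz: "1 + of_real \<xi> * z \<noteq> 0" and "Im u \<noteq> 0"
      using Im_moebius_nonzero[OF that, of "- \<xi>"] by (simp_all add: u_def)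
    have nz': "1 - of_real \<xi> * u \<noteq> 0" using Im_moebius_nonzero(1) \<open>Im u \<noteq> 0\<close> .
    have "1 - of_real \<xi> * u = 1 / (1 + of_real \<xi> * z)"
      using nz by (simp add: u_def field_simps)
    then have "u / (1 - of_real \<xi> * u) = z"
      using nz by (simp add: u_def)
    with poly_moebius_poly[OF degree_polar_deriv[OF deg] nz'] nz'
    show "poly (cpoly ?r) z = 0 \<longleftrightarrow> poly (cpoly ?M) (z / (1 + of_real \<xi> * z)) = 0"
      "Im (z / (1 + of_real \<xi> * z)) \<noteq> 0"
      using \<open>Im u \<noteq> 0\<close> by (simp_all add: u_def)
  qed
  show ?thesis
  proof (cases "?M = 0")
    case True
    \<comment> \<open>a vanishing transform means that the polar derivative has all nonreal numbers as zeros\<close>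
    have "infinite (Complex 0 ` {0<..})"
      by (subst finite_image_iff) (auto simp: inj_on_def infinite_Ioi)
    moreover have "Complex 0 ` {0<..} \<subseteq> {z. poly (cpoly ?r) z = 0}"
      using eq True by auto
    ultimately have "?r = 0"
      using poly_roots_finite[of "cpoly ?r"] finite_subset by auto
    then show ?thesis by simp
  next
    case False
    then show ?thesis
      unfolding only_real_zeros_iff_upper using eq only_real_zerosD[OF M False] by auto
  qed
qed

definition jensen :: "nat \<Rightarrow> (nat \<Rightarrow> real) \<Rightarrow> real poly" where
  "jensen n \<gamma> = (\<Sum>k\<le>n. monom (real (n choose k) * \<gamma> k) k)"

lemma coeff_jensen [simp]: "coeff (jensen n \<gamma>) k = real (n choose k) * \<gamma> k"
  by (simp add: jensen_def coeff_sum)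

lemma degree_jensen: "degree (jensen n \<gamma>) \<le> n"
  by (rule degree_le) simp

lemma polar_deriv_jensen:
  "polar_deriv (Suc n) \<xi> (jensen (Suc n) \<gamma>) =
    smult (real (Suc n)) (jensen n (\<lambda>k. \<gamma> (Suc k) - \<xi> * \<gamma> k))"
proof (rule poly_eqI)
  fix k
  have 1: "real (Suc k) * real (Suc n choose Suc k) = real (Suc n) * real (n choose k)"
    unfolding of_nat_mult[symmetric] by (simp only: Suc_times_binomial)
  have 2: "(real (Suc n) - real k) * real (Suc n choose k) = real (Suc n) * real (n choose k)"
  proof (cases "k \<le> Suc n")
    case True
    then have "real (Suc n) - real k = real (Suc n - k)" by simp
    then show ?thesis
      using binomial_absorb_comp[of "Suc n" k] by (simp only: diff_Suc_1 flip: of_nat_mult)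
  qed (simp add: binomial_eq_0 del: binomial_Suc_Suc)
  show "coeff (polar_deriv (Suc n) \<xi> (jensen (Suc n) \<gamma>)) k =
      coeff (smult (real (Suc n)) (jensen n (\<lambda>k. \<gamma> (Suc k) - \<xi> * \<gamma> k))) k"
    unfolding coeff_polar_deriv coeff_jensen coeff_smult
    using arg_cong[OF 1, of "\<lambda>t. t * \<gamma> (Suc k)"] arg_cong[OF 2, of "\<lambda>t. \<xi> * (t * \<gamma> k)"]
    by (simp add: algebra_simps del: of_nat_Suc binomial_Suc_Suc)
qed

definition jensen_real_rooted :: "(nat \<Rightarrow> real) \<Rightarrow> bool" where
  "jensen_real_rooted \<gamma> \<longleftrightarrow> (\<forall>n. only_real_zeros (jensen n \<gamma>))"

text \<open>For \<open>\<xi> = 0\<close> this says that the shifted sequence inherits the property, for \<open>\<xi> = 1\<close> that the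
  sequence of differences does. The intermediate values of \<open>\<xi>\<close> are what makes
  \<open>differences_monotone\<close> work.\<close>

lemma jensen_real_rooted_polar:
  assumes "jensen_real_rooted \<gamma>"
  shows "jensen_real_rooted (\<lambda>k. \<gamma> (Suc k) - \<xi> * \<gamma> k)"
  unfolding jensen_real_rooted_def
proof
  fix n
  have "only_real_zeros (polar_deriv (Suc n) \<xi> (jensen (Suc n) \<gamma>))"
    using assms by (intro polar_derivative_real_rooted degree_jensen) (simp add: jensen_real_rooted_def)
  then show "only_real_zeros (jensen n (\<lambda>k. \<gamma> (Suc k) - \<xi> * \<gamma> k))"
    unfolding polar_deriv_jensen by simp
qed

lemma jensen_real_rooted_log_concave:
  assumes "jensen_real_rooted \<gamma>"
  shows "\<gamma> k * \<gamma> (Suc (Suc k)) \<le> (\<gamma> (Suc k))\<^sup>2"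
  using assms
proof (induction k arbitrary: \<gamma>)
  case 0
  have "jensen 2 \<gamma> = [:\<gamma> 0, 2 * \<gamma> 1, \<gamma> 2:]"
    by (simp add: jensen_def quadratic_as_monoms numeral_2_eq_2)
  then have "only_real_zeros [:\<gamma> 0, 2 * \<gamma> 1, \<gamma> 2:]"
    using 0 unfolding jensen_real_rooted_def by metis
  then show ?case
    using quadratic_real_rooted_discriminant[of "\<gamma> 0" "\<gamma> 1" "\<gamma> 2"] by (simp add: numeral_2_eq_2)
next
  case (Suc k)
  then show ?case using jensen_real_rooted_polar[OF Suc.prems, of 0] by simp
qed

text \<open>Suppose \<open>d (k + 1) < d k\<close> for the differences \<open>d\<close> of \<open>\<gamma>\<close>, and pick \<open>\<xi> < 1\<close> above the ratio
  \<open>d (k + 1) / d k\<close>. The sequence \<open>e j = \<gamma> (j + 1) - \<xi> \<gamma> j\<close> is log-concave, since its Jensen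
  polynomials are polar derivatives of those of \<open>\<gamma>\<close>, and it decreases strictly from \<open>k\<close> to
  \<open>k + 1\<close>. A log-concave sequence that has started to decrease tends to \<open>0\<close> geometrically. But
  \<open>e j \<ge> (1 - \<xi>) \<gamma> j\<close> stays away from \<open>0\<close>.\<close>

lemma differences_monotone:
  assumes J: "jensen_real_rooted \<gamma>" and nonneg: "\<And>k. 0 \<le> \<gamma> k" and mono: "\<And>k. \<gamma> k \<le> \<gamma> (Suc k)"
  shows "\<gamma> (Suc k) - \<gamma> k \<le> \<gamma> (Suc (Suc k)) - \<gamma> (Suc k)"
proof (rule ccontr)
  define d where "d j = \<gamma> (Suc j) - \<gamma> j" for j
  have d_nonneg: "d j \<ge> 0" for j using mono by (simp add: d_def)
  assume "\<not> ?thesis"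
  then have less: "d (Suc k) < d k" by (simp add: d_def)
  then have "d k > 0" using d_nonneg[of "Suc k"] by linarith
  then have "d (Suc k) / d k < 1" using less by simp
  then obtain \<xi> where \<xi>: "\<xi> < 1" "d (Suc k) / d k < \<xi>" using dense by blast
  define e where "e j = \<gamma> (Suc j) - \<xi> * \<gamma> j" for j
  have e: "e j = (1 - \<xi>) * \<gamma> j + d j" for j by (simp add: e_def d_def algebra_simps)
  have log_concave: "e j * e (Suc (Suc j)) \<le> (e (Suc j))\<^sup>2" for j
    using jensen_real_rooted_log_concave[OF jensen_real_rooted_polar[OF J]] unfolding e_def by blast
  have "\<gamma> (Suc k) > 0" using \<open>d k > 0\<close> nonneg[of k] by (simp add: d_def)
  have "\<gamma> (Suc k) \<le> \<gamma> (Suc k + i)" for i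
    by (induction i) (auto intro: order_trans[OF _ mono])
  then have lower: "(1 - \<xi>) * \<gamma> (Suc k) \<le> e (Suc k + i)" for i
    unfolding e using \<xi> d_nonneg by (intro add_increasing2 mult_left_mono) auto
  have low_pos: "(1 - \<xi>) * \<gamma> (Suc k) > 0" using \<xi> \<open>\<gamma> (Suc k) > 0\<close> by simp
  have "e k > 0" unfolding e using \<xi> \<open>d k > 0\<close> nonneg[of k]
    by (intro add_nonneg_pos mult_nonneg_nonneg) auto
  have e_pos: "e (k + i) > 0" for i
    using \<open>e k > 0\<close> lower[of "i - 1"] low_pos by (cases i) auto
  define \<rho> where "\<rho> = e (Suc k) / e k"
  have "e (Suc k) - e k = d (Suc k) - \<xi> * d k" by (simp add: e_def d_def algebra_simps)
  also have "\<dots> < 0" using \<xi>(2) \<open>d k > 0\<close> by (simp add: field_simps)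
  finally have \<rho>: "\<rho> < 1" "\<rho> > 0"
    using \<open>e k > 0\<close> e_pos[of 1] by (simp_all add: \<rho>_def)
  have ratio: "e (k + Suc i) \<le> \<rho> * e (k + i)" for i
  proof (induction i)
    case 0
    show ?case using \<open>e k > 0\<close> by (simp add: \<rho>_def)
  next
    case (Suc i)
    have "e (k + i) * e (k + Suc (Suc i)) \<le> e (k + Suc i) * e (k + Suc i)"
      using log_concave[of "k + i"] by (simp add: power2_eq_square)
    also have "\<dots> \<le> (\<rho> * e (k + i)) * e (k + Suc i)"
      using Suc e_pos[of "Suc i"] by (intro mult_right_mono) auto
    finally have "e (k + i) * e (k + Suc (Suc i)) \<le> e (k + i) * (\<rho> * e (k + Suc i))"
      by (simp add: mult_ac)
    then show ?case using e_pos[of i] by (rule mult_left_le_imp_le)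
  qed
  have geo: "e (k + i) \<le> \<rho> ^ i * e k" for i
  proof (induction i)
    case (Suc i)
    have "e (k + Suc i) \<le> \<rho> * e (k + i)" by (rule ratio)
    also have "\<dots> \<le> \<rho> * (\<rho> ^ i * e k)" using Suc \<rho> by (intro mult_left_mono) auto
    finally show ?case by (simp add: mult_ac)
  qed simp
  have "(\<lambda>i. \<rho> ^ i * e k) \<longlonglongrightarrow> 0 * e k"
    using \<rho> by (intro tendsto_intros LIMSEQ_realpow_zero) auto
  moreover have "(1 - \<xi>) * \<gamma> (Suc k) \<le> \<rho> ^ i * e k" if "i \<ge> 1" for i
    using lower[of "i - 1"] geo[of i] that by simp
  ultimately have "(1 - \<xi>) * \<gamma> (Suc k) \<le> 0 * e k"
    by (intro LIMSEQ_le_const) auto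
  with low_pos show False by simp
qed

definition fwd_diff :: "(nat \<Rightarrow> real) \<Rightarrow> nat \<Rightarrow> real" where
  "fwd_diff \<gamma> k = \<gamma> (Suc k) - \<gamma> k"

lemma iterated_differences_nonneg:
  assumes "jensen_real_rooted \<gamma>" "\<And>k. 0 \<le> \<gamma> k" "\<And>k. \<gamma> k \<le> \<gamma> (Suc k)"
  shows "0 \<le> (fwd_diff ^^ j) \<gamma> 0"
  using assms
proof (induction j arbitrary: \<gamma>)
  case (Suc j)
  have "jensen_real_rooted (fwd_diff \<gamma>)"
    using jensen_real_rooted_polar[OF Suc.prems(1), of 1] by (simp add: fwd_diff_def[abs_def])
  moreover have "0 \<le> fwd_diff \<gamma> k" "fwd_diff \<gamma> k \<le> fwd_diff \<gamma> (Suc k)" for k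
    using Suc.prems(3)[of k] differences_monotone[OF Suc.prems] by (simp_all add: fwd_diff_def)
  ultimately show ?case using Suc.IH[of "fwd_diff \<gamma>"] by (simp add: funpow_swap1)
qed simp

lemma newton_forward: "\<gamma> k = (\<Sum>j\<le>k. real (k choose j) * (fwd_diff ^^ j) \<gamma> 0)"
proof (induction k arbitrary: \<gamma>)
  case (Suc k)
  let ?c = "\<lambda>j. (fwd_diff ^^ j) \<gamma> 0"
  have "\<gamma> (Suc k) = \<gamma> k + fwd_diff \<gamma> k" by (simp add: fwd_diff_def)
  also have "\<dots> = (\<Sum>j\<le>k. real (k choose j) * ?c j) + (\<Sum>j\<le>k. real (k choose j) * ?c (Suc j))"
    using Suc[of \<gamma>] Suc[of "fwd_diff \<gamma>"] by (simp add: funpow_swap1)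
  also have "(\<Sum>j\<le>k. real (k choose j) * ?c j) = (\<Sum>j\<le>Suc k. real (k choose j) * ?c j)"
    by simp
  also have "\<dots> = ?c 0 + (\<Sum>j\<le>k. real (k choose Suc j) * ?c (Suc j))"
    by (subst sum.atMost_Suc_shift) simp
  also have "\<dots> + (\<Sum>j\<le>k. real (k choose j) * ?c (Suc j)) =
      ?c 0 + (\<Sum>j\<le>k. real (Suc k choose Suc j) * ?c (Suc j))"
    by (simp add: sum.distrib algebra_simps)
  also have "\<dots> = (\<Sum>j\<le>Suc k. real (Suc k choose j) * ?c j)"
    by (simp only: sum.atMost_Suc_shift binomial_n_0 of_nat_1 mult_1)
  finally show ?case .
qed simp

text \<open>Writing \<open>E\<close> for the shift, the Jensen polynomial is \<open>(1 + x E)\<^sup>n\<close> applied to \<open>\<gamma>\<close> at \<open>0\<close>. The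
  substitution gives \<open>(1 - x + x E)\<^sup>n\<close>, which is \<open>(1 + x \<Delta>)\<^sup>n\<close> for the forward difference
  \<open>\<Delta> = E - 1\<close>. The proof compares derivatives and constant terms.\<close>

lemma moebius_jensen:
  "moebius_poly n 1 (jensen n \<gamma>) = jensen n (\<lambda>j. (fwd_diff ^^ j) \<gamma> 0)"
proof (induction n arbitrary: \<gamma>)
  case 0
  show ?case by (simp add: moebius_poly_def jensen_def)
next
  case (Suc n)
  let ?M = "moebius_poly (Suc n) 1 (jensen (Suc n) \<gamma>)"
  have "pderiv ?M = moebius_poly n 1 (smult (real (Suc n)) (jensen n (fwd_diff \<gamma>)))"
    by (simp add: pderiv_moebius_poly polar_deriv_jensen fwd_diff_def[abs_def] del: of_nat_Suc)
  also have "\<dots> = smult (real (Suc n)) (moebius_poly n 1 (jensen n (fwd_diff \<gamma>)))"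
    by (simp add: moebius_poly_def smult_sum_right flip: smult_monom mult_smult_left)
  finally have D: "pderiv ?M = smult (real (Suc n)) (jensen n (\<lambda>j. (fwd_diff ^^ j) (fwd_diff \<gamma>) 0))"
    unfolding Suc .
  show ?case
  proof (rule poly_eqI)
    fix j
    show "coeff ?M j = coeff (jensen (Suc n) (\<lambda>j. (fwd_diff ^^ j) \<gamma> 0)) j"
    proof (cases j)
      case 0
      have "poly ?M 0 = \<gamma> 0"
        unfolding moebius_poly_def
        by (subst sum.atMost_Suc_shift) (simp add: poly_sum poly_monom poly_power)
      then show ?thesis using 0 by (simp add: poly_0_coeff_0)
    next
      case (Suc i)
      have "real (Suc i) * coeff ?M (Suc i) =
          real (Suc n) * real (n choose i) * (fwd_diff ^^ Suc i) \<gamma> 0"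
        using arg_cong[OF D, of "\<lambda>p. coeff p i"] by (simp add: coeff_pderiv funpow_swap1 mult_ac)
      also have "real (Suc n) * real (n choose i) = real (Suc i) * real (Suc n choose Suc i)"
        unfolding of_nat_mult[symmetric] by (simp only: Suc_times_binomial)
      finally show ?thesis using Suc by (simp del: binomial_Suc_Suc of_nat_Suc)
    qed
  qed
qed

lemma jensen_differences_real_rooted:
  assumes "jensen_real_rooted \<gamma>"
  shows "only_real_zeros (jensen n (\<lambda>j. (fwd_diff ^^ j) \<gamma> 0))"
  unfolding moebius_jensen[symmetric]
  using assms by (intro moebius_poly_real_rooted degree_jensen) (simp add: jensen_real_rooted_def)

section \<open>A stability-preserving operator in two variables\<close>

text \<open>Elements of \<open>complex poly poly\<close> stand for polynomials \<open>G(x,y)\<close>: the outer variable is \<open>y\<close>, and the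
  coefficients are polynomials in \<open>x\<close>. Thus \<open>pderiv\<close> is \<open>\<partial>\<^sub>y\<close> and \<open>dx\<close> is \<open>\<partial>\<^sub>x\<close>, while \<open>at_x\<close> and
  \<open>at_y\<close> specialize one variable and \<open>diag\<close> sets \<open>y = x\<close>.\<close>

definition lift_y :: "complex poly \<Rightarrow> complex poly poly" where
  "lift_y F = map_poly (\<lambda>c. [:c:]) F"

definition at_x :: "complex \<Rightarrow> complex poly poly \<Rightarrow> complex poly" where
  "at_x x G = map_poly (\<lambda>c. poly c x) G"

definition at_y :: "complex \<Rightarrow> complex poly poly \<Rightarrow> complex poly" where
  "at_y y G = poly G [:y:]"

definition diag :: "complex poly poly \<Rightarrow> complex poly" where
  "diag G = poly G [:0, 1:]"

definition dx :: "complex poly poly \<Rightarrow> complex poly poly" where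
  "dx G = map_poly pderiv G"

lemma coeff_at_x [simp]: "coeff (at_x x G) n = poly (coeff G n) x"
  by (simp add: at_x_def coeff_map_poly)

lemma coeff_dx [simp]: "coeff (dx G) n = pderiv (coeff G n)"
  by (simp add: dx_def coeff_map_poly)

lemma at_x_pCons: "at_x x (pCons c G) = pCons (poly c x) (at_x x G)"
  by (intro poly_eqI) (simp add: coeff_pCons split: nat.splits)

lemma dx_pCons: "dx (pCons c G) = pCons (pderiv c) (dx G)"
  by (intro poly_eqI) (simp add: coeff_pCons split: nat.splits)

lemma at_x_pderiv: "at_x x (pderiv G) = pderiv (at_x x G)"
  by (intro poly_eqI) (simp add: coeff_pderiv)

lemma dx_pderiv: "dx (pderiv G) = pderiv (dx G)"
  by (intro poly_eqI)
    (simp add: coeff_pderiv of_nat_mult_conv_smult pderiv_smult del: of_nat_Suc)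

lemma poly_at_y: "poly (at_y y G) x = poly (at_x x G) y"
  by (induction G) (simp_all add: at_y_def at_x_pCons, simp add: at_x_def)

lemma poly_diag: "poly (diag G) z = poly (at_x z G) z"
  by (induction G) (simp_all add: diag_def at_x_pCons, simp add: at_x_def)

lemma at_y_dx: "at_y y (dx G) = pderiv (at_y y G)"
proof (induction G)
  case (pCons c G)
  then show ?case by (simp add: dx_pCons at_y_def pderiv_add pderiv_smult pderiv_mult)
qed (simp add: at_y_def dx_def)

lemma diag_chain_rule: "pderiv (diag G) = diag (dx G) + diag (pderiv G)"
proof (induction G)
  case (pCons c G)
  then show ?case
    by (simp add: dx_pCons diag_def pderiv_add pderiv_mult pderiv_pCons algebra_simps)
qed (simp add: diag_def dx_def)

text \<open>The map \<open>G \<mapsto> t G + (x - (\<partial>\<^sub>x + \<partial>\<^sub>y) / 2) \<partial>\<^sub>y G\<close>. On the diagonal \<open>\<partial>\<^sub>x + \<partial>\<^sub>y\<close> acts as the ordinary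
  derivative, so \<open>x - (\<partial>\<^sub>x + \<partial>\<^sub>y) / 2\<close> becomes the raising operator of the Hermite polynomials.\<close>

definition hermite_step :: "real \<Rightarrow> complex poly poly \<Rightarrow> complex poly poly" where
  "hermite_step t G = smult [:of_real t:] G + smult [:0, 1:] (pderiv G)
     - smult [:1 / 2:] (dx (pderiv G) + pderiv (pderiv G))"

text \<open>Let \<open>B = \<partial>\<^sub>y G\<close>. Divided by \<open>B\<close>, the new polynomial is
  \<open>t G / B + x - (\<partial>\<^sub>x B / B + \<partial>\<^sub>y B / B) / 2\<close>. By \<open>log_deriv_upper\<close> in the variables \<open>x\<close> and \<open>y\<close>
  separately, each of the terms has nonnegative imaginary part, and \<open>x\<close> a positive one. The
  condition on the leading coefficient in \<open>y\<close>, a nonzero constant, guarantees that \<open>G\<close> has the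
  same degree in \<open>y\<close> for every \<open>x\<close>, so that \<open>B\<close> has no zeros in the region unless \<open>G\<close> is
  constant in \<open>y\<close>; keeping this condition is where \<open>t \<noteq> 0\<close> enters.\<close>

lemma hermite_step_stable:
  assumes G: "\<And>x y. Im x > 0 \<Longrightarrow> Im y > 0 \<Longrightarrow> poly (at_x x G) y \<noteq> 0"
    and lc: "degree G = n" "coeff G n = [:c:]" "c \<noteq> 0" and t: "t > 0"
  shows "\<And>x y. Im x > 0 \<Longrightarrow> Im y > 0 \<Longrightarrow> poly (at_x x (hermite_step t G)) y \<noteq> 0"
    and "degree (hermite_step t G) = n" "coeff (hermite_step t G) n = [:of_real t * c:]"
proof -
  \<comment> \<open>every term except \<open>t G\<close> has smaller degree in \<open>y\<close>\<close>
  have D0: "coeff (pderiv G) m = 0" if "m \<ge> n" for m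
    using that lc(1) by (simp add: coeff_pderiv coeff_eq_0)
  have high: "coeff (hermite_step t G) m = smult (of_real t) (coeff G m)" if "m \<ge> n" for m
    using that by (simp add: hermite_step_def D0 coeff_pderiv[of "pderiv G"])
  show top: "coeff (hermite_step t G) n = [:of_real t * c:]"
    using high[of n] lc by simp
  show "degree (hermite_step t G) = n"
  proof (rule antisym)
    show "degree (hermite_step t G) \<le> n"
      by (rule degree_le) (use high lc in \<open>auto simp: coeff_eq_0\<close>)
    show "n \<le> degree (hermite_step t G)"
      by (rule le_degree) (use top lc t in simp)
  qed
  fix x y :: complex assume x: "Im x > 0" and y: "Im y > 0"
  show "poly (at_x x (hermite_step t G)) y \<noteq> 0"
  proof (cases "n = 0")
    case True
    then have "pderiv G = 0" using lc(1) by (simp add: pderiv_eq_0_iff)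
    then have "at_x x (hermite_step t G) = smult (of_real t) (at_x x G)"
      by (intro poly_eqI) (simp add: hermite_step_def dx_def)
    then show ?thesis using G[OF x y] t by simp
  next
    case False
    have neg: "Im (poly (pderiv (at_x u G)) v / poly (at_x u G) v) < 0"
      if "Im u > 0" "Im v > 0" for u v
    proof (rule log_deriv_upper(2))
      show "degree (at_x u G) > 0"
        using False le_degree[of "at_x u G" n] lc by simp
    qed (use G that in auto)
    define B where "B = pderiv G"
    have Bnz: "poly (at_x u B) v \<noteq> 0" if "Im u > 0" "Im v > 0" for u v
      using neg[OF that] by (auto simp: B_def at_x_pderiv)
    define g b where "g = poly (at_x x G) y" and "b = poly (at_x x B) y"
    define bx where "bx = poly (at_x x (dx B)) y"
    define b_y where "b_y = poly (at_x x (pderiv B)) y"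
    have "b \<noteq> 0" using Bnz x y by (simp add: b_def)
    have "Im (b / g) < 0"
      using neg[OF x y] by (simp add: b_def g_def B_def at_x_pderiv)
    then have "Im (inverse (b / g)) > 0"
      unfolding inverse_complex.sel
      by (intro divide_pos_pos) (auto simp: sum_power2_gt_zero_iff simp del: Im_divide)
    then have 1: "Im (g / b) > 0" by simp
    have "Im (poly (pderiv (at_y y B)) x / poly (at_y y B) x) \<le> 0"
      by (rule log_deriv_upper(1)) (use Bnz x y in \<open>auto simp: poly_at_y\<close>)
    then have 2: "Im (bx / b) \<le> 0"
      by (simp add: bx_def b_def poly_at_y flip: at_y_dx)
    have 3: "Im (b_y / b) \<le> 0"
      unfolding b_y_def b_def at_x_pderiv
      by (rule log_deriv_upper(1)) (use Bnz x y in auto)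
    have "Im (of_real t * (g / b) + x - (bx / b + b_y / b) / 2) > 0"
    proof -
      have "t * Im (g / b) > 0" using 1 t by (intro mult_pos_pos)
      moreover have "Im (of_real t * u + x - (v + w) / 2) = t * Im u + Im x - (Im v + Im w) / 2" for u v w
        by simp
      moreover have "0 < p + q - (r + s) / 2" if "0 < p" "0 < q" "r \<le> 0" "s \<le> 0" for p q r s :: real
        using that by simp
      ultimately show ?thesis using x 2 3 by metis
    qed
    moreover have "of_real t * (g / b) + x - (bx / b + b_y / b) / 2 =
        (of_real t * g + x * b - (bx + b_y) / 2) / b"
      using \<open>b \<noteq> 0\<close> by (simp add: field_simps)
    moreover have "poly (at_x x (hermite_step t G)) y = of_real t * g + x * b - (bx + b_y) / 2"
    proof -
      have "at_x x (hermite_step t G) =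
          smult (of_real t) (at_x x G) + smult x (at_x x B) -
          smult (1 / 2) (at_x x (dx B) + at_x x (pderiv B))"
        by (intro poly_eqI) (simp add: hermite_step_def B_def)
      then show ?thesis by (simp add: g_def b_def bx_def b_y_def)
    qed
    ultimately show ?thesis by (metis div_0 order_less_irrefl zero_complex.sel(2))
  qed
qed

definition hermite_steps :: "real list \<Rightarrow> complex poly \<Rightarrow> complex poly poly" where
  "hermite_steps ts F = foldr hermite_step ts (lift_y F)"

lemma hermite_steps_stable:
  assumes F: "F \<noteq> 0" "\<And>y. Im y > 0 \<Longrightarrow> poly F y \<noteq> 0" and ts: "\<forall>t\<in>set ts. t > 0"
  shows "(\<forall>x y. Im x > 0 \<longrightarrow> Im y > 0 \<longrightarrow> poly (at_x x (hermite_steps ts F)) y \<noteq> 0) \<and>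
    degree (hermite_steps ts F) = degree F \<and>
    (\<exists>c. c \<noteq> 0 \<and> coeff (hermite_steps ts F) (degree F) = [:c:])"
  using ts
proof (induction ts)
  case Nil
  have "at_x x (lift_y F) = F" for x
    by (intro poly_eqI) (simp add: lift_y_def coeff_map_poly)
  moreover have "degree (lift_y F) = degree F"
    unfolding lift_y_def by (rule degree_map_poly) simp
  ultimately show ?case
    using F by (auto simp: hermite_steps_def lift_y_def coeff_map_poly)
next
  case (Cons t ts)
  let ?G = "hermite_steps ts F"
  have eq: "hermite_steps (t # ts) F = hermite_step t ?G" by (simp add: hermite_steps_def)
  obtain c where c: "c \<noteq> 0" "coeff ?G (degree F) = [:c:]" "degree ?G = degree F"
    and st: "\<And>x y. Im x > 0 \<Longrightarrow> Im y > 0 \<Longrightarrow> poly (at_x x ?G) y \<noteq> 0"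
    using Cons by auto
  have "t > 0" using Cons.prems by simp
  then show ?case
    unfolding eq using hermite_step_stable[OF st c(3,2,1)] c(1)
    by (metis mult_eq_0_iff of_real_eq_0_iff order_less_irrefl)
qed

definition hermite_op :: "real list \<Rightarrow> complex poly \<Rightarrow> complex poly" where
  "hermite_op ts F = diag (hermite_steps ts F)"

lemma hermite_op_stable:
  assumes "F \<noteq> 0" "\<And>y. Im y > 0 \<Longrightarrow> poly F y \<noteq> 0" "\<forall>t\<in>set ts. t > 0" "Im z > 0"
  shows "poly (hermite_op ts F) z \<noteq> 0"
  using hermite_steps_stable[OF assms(1-3)] assms(4) by (simp add: hermite_op_def poly_diag)

lemma hermite_step_add: "hermite_step t (G + H) = hermite_step t G + hermite_step t H"
  by (intro poly_eqI) (simp add: hermite_step_def pderiv_add algebra_simps smult_add_right)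

lemma hermite_step_smult: "hermite_step t (smult [:a:] G) = smult [:a:] (hermite_step t G)"
  by (intro poly_eqI) (simp add: hermite_step_def pderiv_smult algebra_simps smult_add_right smult_diff_right)

lemma hermite_step_pderiv: "hermite_step t (pderiv G) = pderiv (hermite_step t G)"
  by (simp add: hermite_step_def pderiv_add pderiv_diff pderiv_smult dx_pderiv)

lemma hermite_steps_add: "hermite_steps ts (F + H) = hermite_steps ts F + hermite_steps ts H"
proof (induction ts)
  case Nil
  show ?case by (intro poly_eqI) (simp add: hermite_steps_def lift_y_def coeff_map_poly)
qed (simp add: hermite_steps_def hermite_step_add)

lemma hermite_steps_smult: "hermite_steps ts (smult a F) = smult [:a:] (hermite_steps ts F)"
proof (induction ts)
  case Nil
  show ?case by (intro poly_eqI) (simp add: hermite_steps_def lift_y_def coeff_map_poly mult.commute)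
qed (simp add: hermite_steps_def hermite_step_smult)

lemma hermite_steps_pderiv: "hermite_steps ts (pderiv F) = pderiv (hermite_steps ts F)"
proof (induction ts)
  case Nil
  show ?case
    by (intro poly_eqI)
      (simp add: hermite_steps_def lift_y_def coeff_map_poly coeff_pderiv of_nat_poly mult.commute)
qed (simp add: hermite_steps_def hermite_step_pderiv)

lemma hermite_op_add: "hermite_op ts (F + H) = hermite_op ts F + hermite_op ts H"
  by (simp add: hermite_op_def hermite_steps_add diag_def)

lemma hermite_op_smult: "hermite_op ts (smult a F) = smult a (hermite_op ts F)"
  by (simp add: hermite_op_def hermite_steps_smult diag_def)

lemma hermite_op_sum: "hermite_op ts (\<Sum>i\<in>A. f i) = (\<Sum>i\<in>A. hermite_op ts (f i))"
proof (induction A rule: infinite_finite_induct)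
  case empty
  then show ?case using hermite_op_smult[of ts 0 0] by simp
next
  case infinite
  then show ?case using hermite_op_smult[of ts 0 0] by simp
qed (simp add: hermite_op_add)

text \<open>All steps commute with \<open>\<partial>\<^sub>y\<close>, so the derivative in the last step may be moved onto \<open>F\<close>.\<close>

lemma hermite_op_Cons:
  "hermite_op (t # ts) F = smult (of_real t) (hermite_op ts F) +
    ([:0, 1:] * hermite_op ts (pderiv F) - smult (1 / 2) (pderiv (hermite_op ts (pderiv F))))"
  by (simp add: hermite_op_def hermite_steps_pderiv diag_chain_rule)
    (simp add: hermite_steps_def hermite_step_def diag_def smult_add_right)

section \<open>Hermite polynomials and their multipliers\<close>

lemma hermite_0: "hermite 0 = 1"
  by (intro poly_eq_poly_eq_iff[THEN iffD1] ext) (simp add: poly_hermite flip: exp_add)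

lemma hermite_Suc: "hermite (Suc k) = [:0, 2:] * hermite k - pderiv (hermite k)"
proof (intro poly_eq_poly_eq_iff[THEN iffD1] ext)
  fix x :: real
  let ?g = "\<lambda>t::real. exp (- (t\<^sup>2))"
  have g: "(deriv ^^ k) ?g t = (-1) ^ k * poly (hermite k) t * exp (- (t\<^sup>2))" for t
  proof -
    have "(-1) ^ k * poly (hermite k) t * exp (- (t\<^sup>2)) =
        ((-1) ^ k * (-1) ^ k) * (exp (t\<^sup>2) * exp (- (t\<^sup>2))) * (deriv ^^ k) ?g t"
      by (simp add: poly_hermite mult_ac)
    also have "((-1) ^ k * (-1) ^ k :: real) = 1" by (simp flip: power_mult_distrib)
    also have "exp (t\<^sup>2) * exp (- (t\<^sup>2)) = 1" by (simp flip: exp_add)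
    finally show ?thesis by simp
  qed
  have "((\<lambda>t. (-1) ^ k * poly (hermite k) t * exp (- (t\<^sup>2))) has_field_derivative
      (-1) ^ k * (poly (pderiv (hermite k)) x - 2 * x * poly (hermite k) x) * exp (- (x\<^sup>2))) (at x)"
    by (rule derivative_eq_intros poly_DERIV refl)+ (simp add: algebra_simps)
  then have "(deriv ^^ Suc k) ?g x =
      (-1) ^ k * (poly (pderiv (hermite k)) x - 2 * x * poly (hermite k) x) * exp (- (x\<^sup>2))"
    unfolding g[symmetric] by (simp add: DERIV_imp_deriv)
  then have "poly (hermite (Suc k)) x =
      - (((-1) ^ k * (-1) ^ k) * (exp (x\<^sup>2) * exp (- (x\<^sup>2))) *
      (poly (pderiv (hermite k)) x - 2 * x * poly (hermite k) x))"
    unfolding poly_hermite[of "Suc k"] by (simp only:) simp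
  also have "((-1) ^ k * (-1) ^ k :: real) = 1" by (simp flip: power_mult_distrib)
  also have "exp (x\<^sup>2) * exp (- (x\<^sup>2)) = 1" by (simp flip: exp_add)
  finally show "poly (hermite (Suc k)) x = poly ([:0, 2:] * hermite k - pderiv (hermite k)) x"
    by simp
qed

lemma pderiv_hermite: "pderiv (hermite k) = smult (2 * real k) (hermite (k - 1))"
proof (induction k)
  case (Suc k)
  have "pderiv (hermite (Suc k)) =
      smult 2 (hermite k) + [:0, 2:] * pderiv (hermite k) - pderiv (pderiv (hermite k))"
    unfolding hermite_Suc pderiv_diff pderiv_mult by (simp add: pderiv_pCons)
  also have "\<dots> = smult 2 (hermite k) + smult (2 * real k) ([:0, 2:] * hermite (k - 1) - pderiv (hermite (k - 1)))"
    unfolding Suc by (simp add: pderiv_smult smult_diff_right)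
  also have "smult (2 * real k) ([:0, 2:] * hermite (k - 1) - pderiv (hermite (k - 1))) =
      smult (2 * real k) (hermite k)"
    by (cases k) (simp_all only: hermite_Suc diff_Suc_1, simp)
  also have "smult 2 (hermite k) + smult (2 * real k) (hermite k) = smult (2 * real (Suc k)) (hermite k)"
    by (simp flip: smult_add_left add: algebra_simps)
  finally show ?case by simp
qed (simp add: hermite_0)

lemma hermite_reflect: "pcompose (hermite k) [:0, -1:] = smult ((-1) ^ k) (hermite k)"
proof (induction k)
  case (Suc k)
  have "pderiv (pcompose (hermite k) [:0, -1:]) = - pcompose (pderiv (hermite k)) [:0, -1:]"
    by (simp add: pderiv_pcompose pderiv_pCons)
  then have "pcompose (pderiv (hermite k)) [:0, -1:] = - smult ((-1) ^ k) (pderiv (hermite k))"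
    unfolding Suc by (simp add: pderiv_smult)
  then show ?case
    by (simp add: hermite_Suc pcompose_diff pcompose_mult pcompose_pCons pcompose_smult Suc smult_diff_right mult.commute)
qed (simp add: hermite_0 one_pCons pcompose_pCons)

text \<open>The eigenvalues of \<open>hermite_op ts\<close> on the Hermite polynomials, as read off from
  \<open>hermite_op_Cons\<close>: lowering \<open>H\<^sub>k\<close> produces the factor \<open>2 k\<close>, and \<open>x - D / 2\<close> raises it back with
  the factor \<open>1 / 2\<close>.\<close>

fun step_weight :: "real list \<Rightarrow> nat \<Rightarrow> real" where
  "step_weight [] k = 1"
| "step_weight (t # ts) k = t * step_weight ts k + real k * step_weight ts (k - 1)"

lemma hermite_op_hermite:
  "hermite_op ts (cpoly (hermite k)) = smult (of_real (step_weight ts k)) (cpoly (hermite k))"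
proof (induction ts arbitrary: k)
  case Nil
  show ?case
    by (intro poly_eq_poly_eq_iff[THEN iffD1] ext)
      (simp add: hermite_op_def hermite_steps_def poly_diag, simp add: at_x_def lift_y_def map_poly_map_poly o_def)
next
  case (Cons t ts)
  let ?h = "\<lambda>k. cpoly (hermite k)"
  have D: "hermite_op ts (pderiv (?h k)) = smult (of_real (2 * real k * step_weight ts (k - 1))) (?h (k - 1))"
    by (simp add: pderiv_hermite hermite_op_smult Cons flip: cpoly_pderiv)
  show ?case
  proof (cases k)
    case 0
    then show ?thesis unfolding hermite_op_Cons D by (simp add: Cons)
  next
    case (Suc j)
    have "[:0, 1:] * ?h j - smult (1 / 2) (pderiv (?h j)) = smult (1 / 2) (?h k)"
      unfolding Suc hermite_Suc by (simp add: cpoly_pderiv smult_diff_right)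
    moreover have "[:0, 1:] * smult c (?h j) - smult (1 / 2) (pderiv (smult c (?h j))) =
        smult c ([:0, 1:] * ?h j - smult (1 / 2) (pderiv (?h j)))" for c
      by (simp add: pderiv_smult smult_diff_right mult.commute)
    ultimately have "[:0, 1:] * smult c (?h j) - smult (1 / 2) (pderiv (smult c (?h j))) =
        smult (c / 2) (?h k)" for c
      by simp
    then have "hermite_op (t # ts) (?h k) = smult (of_real t * of_real (step_weight ts k)) (?h k) +
        smult (of_real (2 * real k * step_weight ts (k - 1)) / 2) (?h k)"
      unfolding hermite_op_Cons D Cons using Suc by simp
    also have "of_real (2 * real k * step_weight ts (k - 1)) / 2 =
        complex_of_real (real k * step_weight ts (k - 1))"
      by simp
    finally show ?thesis by (simp add: smult_add_left)
  qed
qed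

text \<open>The number \<open>\<Sum> p\<^sub>j k(k-1)\<cdots>(k-j+1)\<close>, that is, \<open>P\<close> with the powers replaced by falling factorials.\<close>

definition newton_value :: "real poly \<Rightarrow> nat \<Rightarrow> real" where
  "newton_value P k = (\<Sum>j\<le>k. fact j * real (k choose j) * coeff P j)"

lemma step_weight_eq: "step_weight ts k = newton_value (\<Prod>t\<leftarrow>ts. [:t, 1:]) k"
proof (induction ts arbitrary: k)
  case Nil
  show ?case by (simp add: newton_value_def sum.atMost_shift)
next
  case (Cons t ts)
  define P where "P = (\<Prod>t\<leftarrow>ts. [:t, 1:])"
  have "newton_value ([:t, 1:] * P) k =
      t * newton_value P k + (\<Sum>j\<le>k. fact j * real (k choose j) * coeff (pCons 0 P) j)"
    by (simp add: newton_value_def sum_distrib_left sum.distrib algebra_simps)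
  also have "(\<Sum>j\<le>k. fact j * real (k choose j) * coeff (pCons 0 P) j) = real k * newton_value P (k - 1)"
  proof (cases k)
    case (Suc m)
    have "fact (Suc j) * real (Suc m choose Suc j) = real (Suc m) * (fact j * real (m choose j))" for j
      using arg_cong[OF Suc_times_binomial[of j m], of real]
      by (simp only: fact_Suc of_nat_mult mult_ac)
    then show ?thesis
      unfolding Suc by (subst sum.atMost_Suc_shift)
        (simp add: newton_value_def sum_distrib_left mult.assoc del: binomial_Suc_Suc of_nat_Suc fact_Suc)
  qed simp
  finally show ?case by (simp add: Cons P_def)
qed

text \<open>The multiplier acts as \<open>hermite_op ts\<close>, which preserves nonvanishing on the upper half-plane.\<close>

lemma positive_product_multiplier:
  assumes "\<forall>t\<in>set ts. t > 0"
  shows "multiplier_sequence hermite (newton_value (\<Prod>t\<leftarrow>ts. [:t, 1:]))"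
  unfolding multiplier_sequence_def
proof (intro allI impI)
  fix n a
  let ?f = "\<Sum>k\<le>n. smult (a k) (hermite k)"
  let ?g = "\<Sum>k\<le>n. smult (a k * newton_value (\<Prod>t\<leftarrow>ts. [:t, 1:]) k) (hermite k)"
  assume RR: "only_real_zeros ?f"
  have g: "cpoly ?g = hermite_op ts (cpoly ?f)"
    by (simp add: cpoly_sum hermite_op_sum hermite_op_smult hermite_op_hermite step_weight_eq)
  show "only_real_zeros ?g"
  proof (cases "?f = 0")
    case True
    then have "cpoly ?g = 0" unfolding g using hermite_op_smult[of ts 0 0] by simp
    then show ?thesis by simp
  next
    case False
    have "poly (cpoly ?g) z \<noteq> 0" if "Im z > 0" for z
      unfolding g using only_real_zerosD[OF RR False] False assms that
      by (intro hermite_op_stable) auto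
    then show ?thesis unfolding only_real_zeros_iff_upper by blast
  qed
qed

lemma multiplier_sequence_closed:
  assumes lim: "\<And>k. ((\<lambda>m. \<Gamma> m k) \<longlongrightarrow> \<gamma> k) F" and F: "F \<noteq> bot"
    and MS: "eventually (\<lambda>m. multiplier_sequence q (\<Gamma> m)) F"
  shows "multiplier_sequence q \<gamma>"
  unfolding multiplier_sequence_def
proof (intro allI impI)
  fix n a
  assume RR: "only_real_zeros (\<Sum>k\<le>n. smult (a k) (q k))"
  define N where "N = Max ((\<lambda>k. degree (q k)) ` {..n})"
  show "only_real_zeros (\<Sum>k\<le>n. smult (a k * \<gamma> k) (q k))"
  proof (rule only_real_zeros_closed[OF _ _ F])
    show "coeff_lim (\<lambda>m. \<Sum>k\<le>n. smult (a k * \<Gamma> m k) (q k)) (\<Sum>k\<le>n. smult (a k * \<gamma> k) (q k)) F"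
      by (intro coeff_lim_sum coeff_lim_smult coeff_lim_const tendsto_intros lim)
    show "degree (\<Sum>k\<le>n. smult (a k * \<Gamma> m k) (q k)) \<le> N" for m
      by (intro degree_sum_le order_trans[OF degree_smult_le]) (auto simp: N_def)
    show "eventually (\<lambda>m. only_real_zeros (\<Sum>k\<le>n. smult (a k * \<Gamma> m k) (q k))) F"
      using MS by eventually_elim (rule multiplier_sequenceD[OF _ RR])
  qed
qed

lemma newton_value_tendsto:
  assumes "coeff_lim P p F"
  shows "((\<lambda>m. newton_value (P m) k) \<longlongrightarrow> newton_value p k) F"
  using assms unfolding newton_value_def coeff_lim_def by (auto intro!: tendsto_intros)

lemma nonneg_product_multiplier:
  assumes "\<forall>t\<in>set ts. t \<ge> 0"
  shows "multiplier_sequence hermite (newton_value (\<Prod>t\<leftarrow>ts. [:t, 1:]))"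
proof (rule multiplier_sequence_closed[OF newton_value_tendsto])
  have lim: "((\<lambda>\<epsilon>. t + \<epsilon>) \<longlongrightarrow> t + 0) (at_right 0)" for t :: real
    by (intro tendsto_intros)
  then show "coeff_lim (\<lambda>\<epsilon>. \<Prod>t\<leftarrow>ts. [:t + \<epsilon>, 1:]) (\<Prod>t\<leftarrow>ts. [:t, 1:]) (at_right 0)"
    by (intro coeff_lim_prod_list coeff_lim_linear) simp
  show "eventually (\<lambda>\<epsilon>. multiplier_sequence hermite (newton_value (\<Prod>t\<leftarrow>ts. [:t + \<epsilon>, 1:]))) (at_right 0)"
    using eventually_at_right_less[of 0]
  proof eventually_elim
    case (elim \<epsilon>)
    then show ?case
      using positive_product_multiplier[of "map (\<lambda>t. t + \<epsilon>) ts"] assms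
      by (auto simp: o_def add_nonneg_pos)
  qed
qed simp

lemma multiplier_sequence_scale:
  assumes "multiplier_sequence q \<gamma>"
  shows "multiplier_sequence q (\<lambda>k. c * \<gamma> k)"
proof -
  have "(\<Sum>k\<le>n. smult (a k * (c * \<gamma> k)) (q k)) = smult c (\<Sum>k\<le>n. smult (a k * \<gamma> k) (q k))" for n a
    by (simp add: smult_sum_right mult_ac)
  with assms show ?thesis by (auto simp: multiplier_sequence_def)
qed

lemma poly_prod_list_linear_root:
  "x \<in> set xs \<Longrightarrow> poly (\<Prod>x\<leftarrow>xs. [:- x, 1:]) x = 0" for x :: real
  by (induction xs) auto

text \<open>Nonnegative coefficients exclude positive zeros, so up to a constant \<open>P\<close> is a product of
  factors \<open>t + x\<close> with \<open>t \<ge> 0\<close>.\<close>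

lemma nonneg_coeffs_real_rooted_multiplier:
  assumes RR: "only_real_zeros P" and nonneg: "\<And>i. coeff P i \<ge> 0"
  shows "multiplier_sequence hermite (newton_value P)"
proof -
  obtain c xs where P: "P = smult c (\<Prod>x\<leftarrow>xs. [:- x, 1:])"
    using real_rooted_factorization[OF RR] by blast
  have scale: "newton_value (smult c p) = (\<lambda>k. c * newton_value p k)" for p
    by (simp add: newton_value_def sum_distrib_left mult_ac fun_eq_iff)
  show ?thesis
  proof (cases "P = 0")
    case True
    then show ?thesis by (simp add: newton_value_def multiplier_sequence_def)
  next
    case False
    have "x \<le> 0" if "x \<in> set xs" for x
    proof (rule ccontr)
      assume "\<not> x \<le> 0"
      have "poly P x = 0" using that by (simp add: P poly_prod_list_linear_root)
      moreover have "0 < poly P x"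
      proof -
        have "x > 0" using \<open>\<not> x \<le> 0\<close> by simp
        have "coeff P (degree P) \<noteq> 0" using False by (simp add: leading_coeff_0_iff)
        then have "coeff P (degree P) > 0" using nonneg[of "degree P"] by linarith
        then have "0 < coeff P (degree P) * x ^ degree P"
          using \<open>x > 0\<close> by simp
        also have "\<dots> \<le> (\<Sum>i\<le>degree P. coeff P i * x ^ i)"
          using nonneg \<open>x > 0\<close> by (intro member_le_sum mult_nonneg_nonneg) auto
        also have "\<dots> = poly P x" by (simp add: poly_altdef)
        finally show ?thesis .
      qed
      ultimately show False by simp
    qed
    then have "multiplier_sequence hermite (newton_value (\<Prod>t\<leftarrow>map uminus xs. [:t, 1:]))"
      by (intro nonneg_product_multiplier) auto
    then show ?thesis
      unfolding P scale by (intro multiplier_sequence_scale) (simp add: o_def)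
  qed
qed

lemma binomial_over_power_tendsto:
  "(\<lambda>m. real (m choose j) / real m ^ j) \<longlonglongrightarrow> 1 / fact j"
proof (induction j)
  case (Suc j)
  have "(\<lambda>m. real (m choose j) / real m ^ j * ((1 - real j / real m) / real (Suc j)))
      \<longlonglongrightarrow> 1 / fact j * ((1 - 0) / real (Suc j))"
    by (intro tendsto_intros Suc tendsto_divide_0[OF tendsto_const] filterlim_real_sequentially
        tendsto_mult tendsto_divide tendsto_diff filterlim_at_top_imp_at_infinity) simp_all
  moreover have "eventually (\<lambda>m. real (m choose j) / real m ^ j * ((1 - real j / real m) / real (Suc j)) =
      real (m choose Suc j) / real m ^ Suc j) sequentially"
    using eventually_gt_at_top[of j]
  proof eventually_elim
    case (elim m)
    have "Suc j * (m choose Suc j) = (m choose j) * (m - j)"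
      using binomial_absorb_comp[of m j] Suc_times_binomial[of j "m - 1"] elim
      by (cases m) (auto simp: mult.commute simp del: binomial_Suc_Suc)
    then have "real (Suc j) * real (m choose Suc j) = real (m choose j) * (real m - real j)"
      using elim by (metis of_nat_diff of_nat_mult order_less_imp_le)
    then have *: "real (m choose Suc j) = real (m choose j) * (real m - real j) / real (Suc j)"
      by (simp add: field_simps del: of_nat_Suc binomial_Suc_Suc)
    show ?case unfolding * using elim by (simp add: field_simps del: of_nat_Suc)
  qed
  ultimately show ?case
    by (simp add: tendsto_cong mult.commute)
qed simp

text \<open>At a zero in the upper half-plane \<open>f' / f\<close> would be equal to \<open>c + d z\<close>, which has positive imaginary
  part, against \<open>log_deriv_upper\<close>.\<close>

lemma real_rooted_linear_minus_pderiv: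
  assumes "only_real_zeros f" "d > 0"
  shows "only_real_zeros ([:c, d:] * f - pderiv f)"
proof (cases "f = 0")
  case False
  have fz: "poly (cpoly f) w \<noteq> 0" if "Im w > 0" for w
    using only_real_zerosD[OF assms(1) False] that by simp
  have "poly (cpoly ([:c, d:] * f - pderiv f)) z \<noteq> 0" if "Im z > 0" for z
  proof
    let ?l = "poly (pderiv (cpoly f)) z / poly (cpoly f) z"
    assume "poly (cpoly ([:c, d:] * f - pderiv f)) z = 0"
    then have "(of_real c + of_real d * z) * poly (cpoly f) z = poly (pderiv (cpoly f)) z"
      by (simp add: cpoly_pderiv algebra_simps)
    then have "of_real c + of_real d * z = ?l"
      using fz[OF \<open>Im z > 0\<close>] by (simp add: divide_simps)
    then have "Im (of_real c + of_real d * z) = Im ?l" by (rule arg_cong)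
    moreover have "Im (of_real c + of_real d * z) = d * Im z" by simp
    moreover have "Im ?l \<le> 0" by (rule log_deriv_upper(1)[OF fz \<open>Im z > 0\<close>])
    moreover have "d * Im z > 0" using \<open>d > 0\<close> \<open>Im z > 0\<close> by simp
    ultimately show False by linarith
  qed
  then show ?thesis unfolding only_real_zeros_iff_upper by blast
qed simp

lemma only_real_zeros_hermite: "only_real_zeros (hermite k)"
proof (induction k)
  case 0
  show ?case using only_real_zeros_const[of 1] by (simp add: hermite_0 one_pCons)
next
  case (Suc k)
  then show ?case using real_rooted_linear_minus_pderiv[OF Suc, of 2 0] by (simp add: hermite_Suc)
qed

lemma hermite_adjacent_real_rooted:
  "only_real_zeros (smult a (hermite i) + smult b (hermite (Suc i)))"
proof (cases "b = 0")
  case False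
  have "smult a (hermite i) + smult b (hermite (Suc i)) =
      smult b ([:a / b, 2:] * hermite i - pderiv (hermite i))"
    unfolding hermite_Suc using False by (simp add: smult_add_right smult_diff_right algebra_simps)
  then show ?thesis using real_rooted_linear_minus_pderiv[OF only_real_zeros_hermite, of 2] by simp
qed (simp add: only_real_zeros_hermite)

section \<open>From the constraints to Hermite multiplier sequences\<close>

text \<open>Newton's forward difference formula writes \<open>\<beta> k\<close> as \<open>\<Sum> c\<^sub>j / j! k(k-1)\<cdots>(k-j+1)\<close>. The
  coefficients \<open>c\<^sub>j / j!\<close> are the limits of those of \<open>\<Sum> binomial(m,j) c\<^sub>j (x / m)\<^sup>j\<close>, which is
  real-rooted with nonnegative coefficients.\<close>

lemma nondecreasing_hermite_multiplier:
  assumes J: "jensen_real_rooted \<beta>" and nonneg: "\<And>k. 0 \<le> \<beta> k" and mono: "\<And>k. \<beta> k \<le> \<beta> (Suc k)"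
  shows "multiplier_sequence hermite \<beta>"
proof -
  define c where "c j = (fwd_diff ^^ j) \<beta> 0" for j
  have c: "c j \<ge> 0" for j
    unfolding c_def by (rule iterated_differences_nonneg[OF J nonneg mono])
  define P where "P m = pcompose (jensen m c) [:0, 1 / real m:]" for m
  have coeffP: "coeff (P m) j = real (m choose j) / real m ^ j * c j" for m j
    by (simp add: P_def coeff_pcompose_linear power_divide)
  have MS: "multiplier_sequence hermite (newton_value (P m))" if "m > 0" for m
  proof (rule nonneg_coeffs_real_rooted_multiplier)
    show "only_real_zeros (P m)"
      using jensen_differences_real_rooted[OF J] that
      unfolding P_def c_def[abs_def] by (subst only_real_zeros_pcompose_scale) auto
    show "coeff (P m) i \<ge> 0" for i
      unfolding coeffP using c[of i] by simp
  qed
  have lim: "(\<lambda>m. newton_value (P m) k) \<longlonglongrightarrow> \<beta> k" for k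
  proof -
    have "(\<lambda>m. newton_value (P m) k) \<longlonglongrightarrow>
        (\<Sum>j\<le>k. fact j * real (k choose j) * (1 / fact j * c j))"
      unfolding newton_value_def coeffP
      by (intro tendsto_sum tendsto_mult tendsto_const binomial_over_power_tendsto)
    also have "(\<Sum>j\<le>k. fact j * real (k choose j) * (1 / fact j * c j)) = \<beta> k"
      by (subst newton_forward[of \<beta> k]) (simp add: c_def)
    finally show ?thesis .
  qed
  have "eventually (\<lambda>m. multiplier_sequence hermite (newton_value (P m))) sequentially"
    using eventually_gt_at_top[of 0] by eventually_elim (rule MS)
  then show ?thesis by (rule multiplier_sequence_closed[OF lim sequentially_bot])
qed

lemma hermite_multiplier_alternate:
  assumes "multiplier_sequence hermite \<gamma>"
  shows "multiplier_sequence hermite (\<lambda>k. (-1) ^ k * \<gamma> k)"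
  unfolding multiplier_sequence_def
proof (intro allI impI)
  fix n a
  assume "only_real_zeros (\<Sum>k\<le>n. smult (a k) (hermite k))"
  then have "only_real_zeros (\<Sum>k\<le>n. smult (a k * \<gamma> k) (hermite k))"
    by (rule multiplier_sequenceD[OF assms])
  then have "only_real_zeros (pcompose (\<Sum>k\<le>n. smult (a k * \<gamma> k) (hermite k)) [:0, -1:])"
    by (subst only_real_zeros_pcompose_scale) auto
  then show "only_real_zeros (\<Sum>k\<le>n. smult (a k * ((-1) ^ k * \<gamma> k)) (hermite k))"
    by (simp add: pcompose_sum pcompose_smult hermite_reflect mult_ac)
qed

lemma two_term_hermite_multiplier:
  assumes "\<And>k. \<gamma> k \<noteq> 0 \<Longrightarrow> k = i \<or> k = Suc i"
  shows "multiplier_sequence hermite \<gamma>"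
  unfolding multiplier_sequence_def
proof (intro allI impI)
  fix n a
  have "(\<Sum>k\<le>n. smult (a k * \<gamma> k) (hermite k)) =
      (\<Sum>k\<in>{i, Suc i}. smult (if k \<le> n then a k * \<gamma> k else 0) (hermite k))"
    using assms by (intro sum.mono_neutral_cong) auto
  then show "only_real_zeros (\<Sum>k\<le>n. smult (a k * \<gamma> k) (hermite k))"
    using hermite_adjacent_real_rooted by simp
qed

lemma hadamard_binomial: "hadamard \<gamma> ([:1, 1:] ^ n) = jensen n \<gamma>"
proof (rule poly_eqI)
  fix k show "coeff (hadamard \<gamma> ([:1, 1:] ^ n)) k = coeff (jensen n \<gamma>) k"
    by (cases "k \<le> n") (simp_all add: coeff_linear_poly_power coeff_eq_0 degree_linear_power)
qed

text \<open>The signs have period two along the support, so they are determined by those of \<open>\<gamma> r\<close> and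
  \<open>\<gamma> (r + 1)\<close>.\<close>

lemma sign_pattern:
  fixes \<gamma> :: "nat \<Rightarrow> real"
  assumes supp: "\<And>k. \<gamma> k \<noteq> 0 \<longleftrightarrow> r \<le> k" and same: "\<And>k. 0 \<le> \<gamma> k * \<gamma> (k + 2)"
  obtains s \<sigma> where "s = 1 \<or> s = -1" "\<sigma> = 1 \<or> \<sigma> = -1" "\<And>k. \<gamma> k = s * \<sigma> ^ k * \<bar>\<gamma> k\<bar>"
proof -
  define \<sigma> where "\<sigma> = sgn (\<gamma> r * \<gamma> (Suc r))"
  \<comment> \<open>the factor \<open>\<sigma>\<^sup>r\<close> makes up for counting the exponent from 0 instead of from \<open>r\<close>\<close>
  define s where "s = sgn (\<gamma> r) * \<sigma> ^ r"
  have \<sigma>: "\<sigma> = 1 \<or> \<sigma> = -1"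
    using supp[of r] supp[of "Suc r"] unfolding \<sigma>_def by (auto simp: sgn_real_def)
  then have [simp]: "\<sigma> * \<sigma> = 1" by auto
  have sq: "\<sigma> ^ k * \<sigma> ^ k = 1" for k by (simp flip: power_mult_distrib)
  have "s = 1 \<or> s = -1"
    using supp[of r] \<sigma> unfolding s_def by (cases "even r") (auto simp: sgn_real_def)
  moreover have "sgn (\<gamma> (r + i)) = s * \<sigma> ^ (r + i)" for i
  proof (induction i rule: induct_nat_012)
    case 0
    show ?case using sq[of r] by (simp add: s_def mult.assoc)
  next
    case 1
    have "s * \<sigma> ^ (r + 1) = sgn (\<gamma> r) * (\<sigma> ^ r * \<sigma> ^ r) * \<sigma>" by (simp add: s_def mult_ac)
    also have "\<dots> = (sgn (\<gamma> r) * sgn (\<gamma> r)) * sgn (\<gamma> (Suc r))"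
      unfolding sq by (simp add: \<sigma>_def sgn_mult mult.assoc)
    also have "sgn (\<gamma> r) * sgn (\<gamma> r) = 1" using supp[of r] by (auto simp: sgn_real_def)
    finally show ?case by simp
  next
    case (ge2 i)
    have "sgn (\<gamma> (r + i + 2)) = sgn (\<gamma> (r + i))"
      using same[of "r + i"] supp[of "r + i"] supp[of "r + i + 2"]
      by (auto simp: sgn_real_def zero_le_mult_iff)
    with ge2 show ?case by (simp add: mult_ac)
  qed
  then have "sgn (\<gamma> k) = s * \<sigma> ^ k" if "r \<le> k" for k
    using that by (metis le_add_diff_inverse)
  then have "\<gamma> k = s * \<sigma> ^ k * \<bar>\<gamma> k\<bar>" for k
    using supp[of k] by (cases "r \<le> k") (metis mult_sgn_abs, simp)
  ultimately show ?thesis using that \<sigma> by blast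
qed

text \<open>If the support is infinite, \<open>\<bar>\<gamma>\<bar>\<close> is nondecreasing: a strict decrease from \<open>k\<close> to \<open>k + 1\<close>
  would continue to \<open>k + 2\<close> by log-concavity, contradicting \<open>abs_multiplier_le_two_steps\<close>. Constant
  factors and, by the parity of the Hermite polynomials, alternating signs do not matter.\<close>

theorem theorem6:
  fixes q :: "nat \<Rightarrow> real poly" and \<gamma> :: "nat \<Rightarrow> real"
  assumes "simple_set q"
    and "\<And>k. only_simple_real_zeros (q k)"
    and "\<And>k. lead_coeff (q k) > 0"
    and "multiplier_sequence q \<gamma>"
  shows "multiplier_sequence hermite \<gamma>"
  using assms(1,2,4)
proof (cases rule: multiplier_support)
  case (two i)
  then show ?thesis by (rule two_term_hermite_multiplier)
next
  case (tail r)
  have had: "only_real_zeros (hadamard \<gamma> p)" if "only_real_zeros p" for p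
    using hadamard_real_rooted[OF assms(1,4) that] .
  have same_sign: "0 \<le> \<gamma> k * \<gamma> (k + 2)" for k
    using had by (rule multipliers_two_steps_same_sign)
  obtain s \<sigma> where s: "s = 1 \<or> s = -1" and \<sigma>: "\<sigma> = 1 \<or> \<sigma> = -1"
    and \<gamma>: "\<And>k. \<gamma> k = s * \<sigma> ^ k * \<bar>\<gamma> k\<bar>"
    using sign_pattern[OF tail same_sign] by blast
  define \<beta> where "\<beta> k = \<bar>\<gamma> k\<bar>" for k
  have \<beta>: "\<beta> k = s * \<sigma> ^ k * \<gamma> k" for k
  proof -
    have "s * \<sigma> ^ k * \<gamma> k = (s * s) * (\<sigma> * \<sigma>) ^ k * \<beta> k"
      by (subst \<gamma>) (simp add: \<beta>_def power_mult_distrib mult_ac)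
    then show ?thesis using s \<sigma> by auto
  qed
  have "jensen_real_rooted \<beta>"
    unfolding jensen_real_rooted_def
  proof
    fix n
    have "jensen n \<beta> = smult s (pcompose (hadamard \<gamma> ([:1, 1:] ^ n)) [:0, \<sigma>:])"
      unfolding hadamard_binomial by (intro poly_eqI) (simp add: coeff_pcompose_linear \<beta> mult_ac)
    then show "only_real_zeros (jensen n \<beta>)"
      using had[OF only_real_zeros_power[of "[:1, 1:]" n]] \<sigma>
      by (auto simp: only_real_zeros_pcompose_scale)
  qed
  moreover have "\<beta> k \<le> \<beta> (Suc k)" for k
  proof (cases "r \<le> k")
    case False
    then have "\<beta> k = 0" using tail by (auto simp: \<beta>_def)
    then show ?thesis by (simp add: \<beta>_def)
  next
    case True
    show ?thesis
    proof (rule ccontr)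
      assume less: "\<not> \<beta> k \<le> \<beta> (Suc k)"
      have pos: "\<beta> k > 0" "\<beta> (Suc k) > 0"
        using True tail[of k] tail[of "Suc k"] by (simp_all add: \<beta>_def)
      have "\<beta> k * \<beta> (k + 2) = \<gamma> k * \<gamma> (k + 2)"
        using same_sign[of k] unfolding \<beta>_def by (simp flip: abs_mult)
      also have "\<dots> \<le> (\<beta> (Suc k))\<^sup>2"
        using multipliers_log_concave[OF had, of k] by (simp add: \<beta>_def)
      also have "\<dots> < \<beta> k * \<beta> (Suc k)"
        using less pos by (simp add: power2_eq_square)
      finally have "\<beta> (k + 2) < \<beta> (Suc k)" using pos by simp
      moreover have "\<beta> k \<le> \<beta> (k + 2)"
        using abs_multiplier_le_two_steps[OF assms, of k] tail[of "k + 2"] True same_sign[of k]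
        by (simp add: \<beta>_def)
      ultimately show False using less by linarith
    qed
  qed
  ultimately have "multiplier_sequence hermite \<beta>"
    by (intro nondecreasing_hermite_multiplier) (auto simp: \<beta>_def)
  then have "multiplier_sequence hermite (\<lambda>k. \<sigma> ^ k * \<beta> k)"
    using \<sigma> hermite_multiplier_alternate by auto
  from multiplier_sequence_scale[OF this, of s]
  have "multiplier_sequence hermite (\<lambda>k. s * \<sigma> ^ k * \<beta> k)" by (simp add: mult.assoc)
  also have "(\<lambda>k. s * \<sigma> ^ k * \<beta> k) = \<gamma>" using \<gamma> by (simp add: \<beta>_def fun_eq_iff)
  finally show ?thesis .
qed

end
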